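(* Let $\mathcal H$ be a real Hilbert space and let $U_i\colon\mathcal{H}\to\mathcal{H}$ be a cutter for each $i\in I:=\{1,\ldots,M\}$, such that $C:=\bigcap_{i\in I} \operatorname{Fix} U_i \neq \emptyset$. Let the sequence $\{x^k\}_{k=0}^{\infty}$ be defined by $$x^0\in\mathcal{H} \qquad \text{and} \qquad x^{k+1} := x^k+\lambda_k\sigma_k(x^k)\left(\sum_{i\in I_k} \omega_i^k U_{i} x^{k}-x^k\right),\quad k=0,1,2,\ldots,$$ where the control set of indices $I_k\subseteq I$ is nonempty, $\omega_i^k >0$ satisfy $\sum_{i\in I_k}\omega_i^{k}=1$, $\lambda_k>0$ and $\sigma_k\colon\mathcal H \to [1,\infty)$. Assume that $\omega_i^k\in[\omega,1]$ for some $\omega \in (0,1]$, $\lambda_k \in[\underline \lambda, \overline \lambda]$ for some $\underline{\lambda} \in (0,1]$ and $\overline \lambda \in [1,2)$, and $\sigma_k(x)\in [1,\tau_k(x)]$ for each $x\in \mathcal H$, where $$\tau_k(x):=\frac{\sum_{i\in I_k} \omega_i^k \left\|U_ix-x\right\|^2}{\left\|\sum_{i\in I_k} \omega_i^k U_i x-x\right\|^{2}}\quad \text{if } x\notin \bigcap_{i\in I_k}\operatorname{Fix} U_i,$$ and $\tau_k(x):=1$ otherwise. Moreover, assume that the control $\{I_k\}_{k=0}^\infty$ is $s$-intermittent for some integer $s\geq 1$, that is, $I = I_k\cup\ldots\cup I_{k+s-1}$ for each $k=0,1,2,\ldots$. Set $r:=d(x^0,C)$ and $B:=B(P_Cx^0,r)$.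 Then the following statements hold: (i) If each $U_i$ is weakly regular over $B$, then $\{x^k\}_{k=0}^{\infty}$ converges weakly to some point $x^\infty\in C \cap B$. (ii) If each $U_i$ is regular over $B$ and the family $\{\operatorname{Fix} U_i \mid i\in I\}$ is regular over $B$, then the convergence to $x^\infty$ (a point of $C\cap B$) is in norm. (iii) If each $U_i$ is $\delta_i$-linearly regular over $B$ and the family $\{\operatorname{Fix} U_i\mid i \in I\}$ is $\kappa$-linearly regular over $B$, then, with $x^\infty\in C\cap B$ the limit of $\{x^k\}_{k=0}^\infty$, for all $k=0,1,2,\ldots$ we have $$\frac{\delta}{2\kappa}\|x^k-x^\infty\|\leq \max_{i\in I}\|U_ix^k-x^k\|\leq \|x^k-x^\infty\|$$ and $$\|x^k - x^\infty\|\leq 2d(x^0,C)\left(\sqrt[2s]{1-\frac{\omega\rho\delta^2}{s\kappa^2}\min\left\{ \frac 1 {\omega\delta^2},\ \inf_k \lambda_k(2-\lambda_k)\sigma_k(x^k) \right\} }\right)^{k-s+1},$$ where $\delta:=\min_{i\in I}\delta_i$ and $\rho:=\frac{2-\overline{\lambda}}{\overline{\lambda}}$.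
   Context: $\mathcal H$ is a real Hilbert space; $\operatorname{Fix} U$ is the fixed point set of $U$; $P_C$ is the metric projection onto a nonempty closed convex set $C$; $d(x,C)=\inf_{z\in C}\|x-z\|$; $B(z,r)$ is the closed ball with center $z$ and radius $r$. An operator $U\colon\mathcal H\to\mathcal H$ with $\operatorname{Fix}U\ne\emptyset$ is a cutter if $\langle z-Ux,x-Ux\rangle\le 0$ for all $x\in\mathcal H$ and $z\in\operatorname{Fix}U$ (its fixed point set is then closed and convex). Let $S\subseteq\mathcal H$ be nonempty and let $U\colon\mathcal H\to\mathcal H$ have a fixed point. $U$ is weakly regular over $S$ if for every sequence $\{x^k\}\subseteq S$ and $x^\infty\in\mathcal H$, $x^k\rightharpoonup x^\infty$ and $Ux^k-x^k\to0$ imply $x^\infty\in\operatorname{Fix}U$. $U$ is regular over $S$ if for every sequence $\{x^k\}\subseteq S$, $\|Ux^k-x^k\|\to0$ implies $d(x^k,\operatorname{Fix}U)\to0$. $U$ is $\delta_S$-linearly regular over $S$, where $\delta_S>0$, if $\delta_S\, d(x,\operatorname{Fix}U)\le\|Ux-x\|$ for all $x\in S$. A family $\{C_1,\ldots,C_M\}$ of closed convex sets with nonempty intersection $C=\bigcap_{i}C_i$ is regular over $S$ if for every sequence $\{x^k\}\subseteq S$, $\max_i d(x^k,C_i)\to0$ implies $d(x^k,C)\to0$; it is $\kappa$-linearly regular over $S$, where $\kappa>0$, if $d(x,C)\le\kappa\max_i d(x,C_i)$ for all $x\in S$. *)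

theory Defs
  imports "HOL-Analysis.Analysis"
begin

definition Fix :: "('a \<Rightarrow> 'a) \<Rightarrow> 'a set" where
  "Fix U = {x. U x = x}"

text \<open>The library's \<open>closest_point\<close> requires a Heine-Borel space, which excludes
  infinite-dimensional Hilbert spaces.\<close>

definition metric_projection :: "'a::metric_space set \<Rightarrow> 'a \<Rightarrow> 'a" where
  "metric_projection C x = (THE z. z \<in> C \<and> dist x z = infdist x C)"

definition weakly_tendsto :: "(nat \<Rightarrow> 'a::real_inner) \<Rightarrow> 'a \<Rightarrow> bool" where
  "weakly_tendsto x l \<longleftrightarrow> (\<forall>y. (\<lambda>k. inner (x k) y) \<longlonglongrightarrow> inner l y)"

definition cutter :: "('a::real_inner \<Rightarrow> 'a) \<Rightarrow> bool" where
  "cutter U \<longleftrightarrow> Fix U \<noteq> {} \<and>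
     (\<forall>x. \<forall>z\<in>Fix U. inner (z - U x) (x - U x) \<le> 0)"

definition weakly_regular :: "'a::real_inner set \<Rightarrow> ('a \<Rightarrow> 'a) \<Rightarrow> bool" where
  "weakly_regular S U \<longleftrightarrow>
     (\<forall>x l. (\<forall>k. x k \<in> S) \<longrightarrow> weakly_tendsto x l \<longrightarrow>
        (\<lambda>k. U (x k) - x k) \<longlonglongrightarrow> 0 \<longrightarrow> l \<in> Fix U)"

definition regular :: "'a::real_normed_vector set \<Rightarrow> ('a \<Rightarrow> 'a) \<Rightarrow> bool" where
  "regular S U \<longleftrightarrow>
     (\<forall>x. (\<forall>k::nat. x k \<in> S) \<longrightarrow> (\<lambda>k. norm (U (x k) - x k)) \<longlonglongrightarrow> 0 \<longrightarrow>
        (\<lambda>k. infdist (x k) (Fix U)) \<longlonglongrightarrow> 0)"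

definition linearly_regular ::
  "real \<Rightarrow> 'a::real_normed_vector set \<Rightarrow> ('a \<Rightarrow> 'a) \<Rightarrow> bool" where
  "linearly_regular \<delta> S U \<longleftrightarrow>
     0 < \<delta> \<and> (\<forall>x\<in>S. \<delta> * infdist x (Fix U) \<le> norm (U x - x))"

text \<open>The next two notions are meant for a family of closed convex sets with nonempty
  intersection, indexed by a finite nonempty set \<open>I\<close>.\<close>

definition regular_family ::
  "'a::metric_space set \<Rightarrow> 'i set \<Rightarrow> ('i \<Rightarrow> 'a set) \<Rightarrow> bool" where
  "regular_family S I C \<longleftrightarrow>
     (\<forall>x. (\<forall>k::nat. x k \<in> S) \<longrightarrow>
        (\<lambda>k. MAX i\<in>I. infdist (x k) (C i)) \<longlonglongrightarrow> 0 \<longrightarrow>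
        (\<lambda>k. infdist (x k) (\<Inter>i\<in>I. C i)) \<longlonglongrightarrow> 0)"

definition linearly_regular_family ::
  "real \<Rightarrow> 'a::metric_space set \<Rightarrow> 'i set \<Rightarrow> ('i \<Rightarrow> 'a set) \<Rightarrow> bool" where
  "linearly_regular_family \<kappa> S I C \<longleftrightarrow>
     0 < \<kappa> \<and> (\<forall>x\<in>S. infdist x (\<Inter>i\<in>I. C i) \<le> \<kappa> * (MAX i\<in>I. infdist x (C i)))"

text \<open>The upper bound for the extrapolation parameter. For cutters with a common fixed point
  and weights that are positive on \<open>J\<close> and sum to one, the denominator in the first case is
  nonzero.\<close>

definition extrapolation_bound ::
  "'i set \<Rightarrow> ('i \<Rightarrow> real) \<Rightarrow> ('i \<Rightarrow> 'a \<Rightarrow> 'a) \<Rightarrow> 'a::real_normed_vector \<Rightarrow> real" where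
  "extrapolation_bound J w U x =
     (if x \<notin> (\<Inter>i\<in>J. Fix (U i))
      then (\<Sum>i\<in>J. w i * (norm (U i x - x))\<^sup>2) / (norm ((\<Sum>i\<in>J. w i *\<^sub>R U i x) - x))\<^sup>2
      else 1)"

definition intermittent :: "nat \<Rightarrow> 'i set \<Rightarrow> (nat \<Rightarrow> 'i set) \<Rightarrow> bool" where
  "intermittent s I J \<longleftrightarrow> (\<forall>k. I = (\<Union>l\<in>{k..<k + s}. J l))"

end

theory Submission
  imports Defs "HOL-Library.Diagonal_Subsequence"
begin

text \<open>
  One step of the method moves from \<open>y\<close> along the averaged residual \<open>v\<close> of the active operators. The
  cutter inequality says that every residual \<open>U i y - y\<close> points towards each common fixed point \<open>z\<close>, with
  \<open>inner (z - y) (U i y - y) \<ge> (norm (U i y - y))\<^sup>2\<close>, and the extrapolation bound limits the step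
  so that the averaged squared residual still dominates the squared step. Hence the squared distance
  to \<open>z\<close> decreases by at least a constant multiple of the squared step and of each active
  squared residual (\<open>extrapolated_step_descent\<close>). The locale \<open>intermittent_descent\<close> keeps just
  these two inequalities.

  They make the sequence Fejer monotone with respect to \<open>C\<close>, so that it stays in \<open>B\<close>, and force the
  steps and the active residuals to vanish. As every operator is active once in each block of \<open>s\<close>
  indices, every iterate is asymptotically close to one at which a given operator has a small
  residual (\<open>activation_times\<close>). Weak regularity then places all weak limits of subsequences in \<open>C\<close>,
  and Opial's argument together with weak sequential compactness of bounded sequences gives weak
  convergence. Regularity gives \<open>infdist (x k) C \<longlonglongrightarrow> 0\<close> instead, which together with Fejer
  monotonicity makes the sequence Cauchy.

  Under linear regularity the two inequalities are summed over a block. By Cauchy-Schwarz the squared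
  distance of \<open>x k\<close> to any \<open>Fix (U i)\<close> is at most \<open>s\<close> times a constant times the decrease of the squared
  distance to the projection of \<open>x k\<close> onto \<open>C\<close> during the block (\<open>block_decrease\<close>). Hence the squared
  distance to \<open>C\<close> shrinks by a constant factor over each block, and by Fejer monotonicity the distance
  to the limit is at most twice the distance to \<open>C\<close>.

  Weak sequential compactness is derived by elementary means: nested bounded closed convex
  sets in a Hilbert space have a common point by the parallelogram law, which yields both metric
  projections and weak limits.
\<close>

section \<open>Projections and weak sequential compactness in Hilbert space\<close>

text \<open>
  The points of least norm in the sets \<open>K n\<close> form a Cauchy sequence by the parallelogram law. To
  avoid speaking of points of least norm, the proof intersects \<open>K n\<close> with balls whose radii
  slightly exceed the supremum of the distances of the sets from the origin; by the parallelogram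
  law the diameters of these intersections tend to zero.
\<close>

lemma nested_bounded_closed_convex_Inter_nonempty:
  fixes K :: "nat \<Rightarrow> 'a::{real_inner, complete_space} set"
  assumes closed: "\<And>n. closed (K n)" and convex: "\<And>n. convex (K n)"
    and nonempty: "\<And>n. K n \<noteq> {}" and "decseq K" and "bounded (K 0)"
  shows "(\<Inter>n. K n) \<noteq> {}"
proof -
  define d where "d n = infdist 0 (K n)" for n
  obtain R where R: "norm y \<le> R" if "y \<in> K 0" for y
    using \<open>bounded (K 0)\<close> unfolding bounded_iff by blast
  have sub: "K n \<subseteq> K m" if "m \<le> n" for m n
    using \<open>decseq K\<close> that by (auto simp: decseq_def)
  have "d n \<le> R" for n
  proof -
    obtain y where "y \<in> K n"
      using nonempty by blast
    then show ?thesis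
      using R[of y] sub[of 0 n] infdist_le2[of y "K n" 0 R] by (auto simp: d_def)
  qed
  moreover have "incseq d"
    unfolding incseq_def d_def using infdist_mono[OF sub nonempty] by blast
  ultimately obtain D where D: "d \<longlonglongrightarrow> D" "\<And>n. d n \<le> D"
    using incseq_convergent by blast
  have "0 \<le> D"
    using D(2)[of 0] infdist_nonneg[of 0 "K 0"] by (simp add: d_def)
  define L where "L n = K n \<inter> cball 0 (D + 1 / Suc n)" for n
  have near: "(dist y z)\<^sup>2 \<le> 4 * ((D + 1 / Suc n)\<^sup>2 - (d n)\<^sup>2)" if "y \<in> L n" "z \<in> L n" for y z n
  proof -
    have mid: "(1/2) *\<^sub>R y + (1/2) *\<^sub>R z \<in> K n"
      using that convexD[OF convex[of n], of y z "1/2" "1/2"] by (auto simp: L_def)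
    have "d n \<le> norm ((1/2) *\<^sub>R y + (1/2) *\<^sub>R z)"
      using infdist_le[OF mid, of 0] by (simp add: d_def)
    also have "\<dots> = norm (y + z) / 2"
      by (simp flip: scaleR_add_right)
    finally have "(d n)\<^sup>2 \<le> (norm (y + z) / 2)\<^sup>2"
      by (intro power_mono) (auto simp: d_def infdist_nonneg)
    moreover have "(norm y)\<^sup>2 \<le> (D + 1 / Suc n)\<^sup>2" "(norm z)\<^sup>2 \<le> (D + 1 / Suc n)\<^sup>2"
      using that by (auto simp: L_def intro!: power_mono)
    moreover have "(norm (y + z))\<^sup>2 + (dist y z)\<^sup>2 = 2 * (norm y)\<^sup>2 + 2 * (norm z)\<^sup>2"
      by (simp add: dist_norm power2_norm_eq_inner algebra_simps inner_commute)
    ultimately show ?thesis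
      by (simp add: power_divide)
  qed
  have lim: "(\<lambda>n. 4 * ((D + 1 / Suc n)\<^sup>2 - (d n)\<^sup>2)) \<longlonglongrightarrow> 4 * ((D + 0)\<^sup>2 - D\<^sup>2)"
    by (intro tendsto_intros D(1) LIMSEQ_Suc[OF lim_1_over_n])
  have "\<exists>a. \<forall>n. a \<in> L n"
  proof (rule decreasing_closed_nest[of L])
    show "\<exists>a. \<forall>n. a \<in> L n" if "\<And>n. a \<in> L n" for a
      using that by blast
    show "closed (L n)" for n
      unfolding L_def by (intro closed_Int closed closed_cball)
    show "L n \<noteq> {}" for n
    proof -
      have "(INF y\<in>K n. dist 0 y) < D + 1 / Suc n"
        using D(2)[of n] unfolding d_def infdist_notempty[OF nonempty]
        by (rule order_le_less_trans) simp
      then obtain y where "y \<in> K n" "dist 0 y < D + 1 / Suc n"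
        using cInf_lessD[of "dist 0 ` K n"] nonempty[of n] by auto
      then have "y \<in> L n"
        by (auto simp: L_def)
      then show ?thesis by blast
    qed
    show "L n \<subseteq> L m" if "m \<le> n" for m n
    proof -
      have "1 / real (Suc n) \<le> 1 / real (Suc m)"
        using that by (simp add: field_simps)
      then show ?thesis
        using sub[OF that] by (auto simp: L_def)
    qed
    show "\<exists>n. \<forall>x\<in>L n. \<forall>y\<in>L n. dist x y < e" if "e > 0" for e
    proof -
      have "\<forall>\<^sub>F n in sequentially. 4 * ((D + 1 / Suc n)\<^sup>2 - (d n)\<^sup>2) < e\<^sup>2"
        using order_tendstoD(2)[OF lim, of "e\<^sup>2"] that by simp
      then obtain n where n: "4 * ((D + 1 / Suc n)\<^sup>2 - (d n)\<^sup>2) < e\<^sup>2"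
        using eventually_happens trivial_limit_sequentially by blast
      have "dist y z < e" if "y \<in> L n" "z \<in> L n" for y z
        using near[OF that] n \<open>e > 0\<close> by (intro power2_less_imp_less[of _ e]) auto
      then show ?thesis by blast
    qed
  qed
  then show ?thesis
    by (auto simp: L_def)
qed

text \<open>The balls around \<open>y\<close> whose radii decrease to the distance cut \<open>C\<close> in a nested sequence.\<close>

lemma infdist_attained_closed_convex:
  fixes C :: "'a::{real_inner, complete_space} set"
  assumes "closed C" "convex C" "C \<noteq> {}"
  obtains p where "p \<in> C" "dist y p = infdist y C"
proof -
  define K where "K n = C \<inter> cball y (infdist y C + 1 / Suc n)" for n
  have "(\<Inter>n. K n) \<noteq> {}"
  proof (rule nested_bounded_closed_convex_Inter_nonempty)
    show "closed (K n)" "convex (K n)" for n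
      unfolding K_def using assms by (auto intro: closed_Int convex_Int)
    show "K n \<noteq> {}" for n
    proof -
      have "(INF c\<in>C. dist y c) < infdist y C + 1 / Suc n"
        using assms by (simp add: infdist_notempty)
      then obtain c where "c \<in> C" "dist y c < infdist y C + 1 / Suc n"
        using cInf_lessD[of "dist y ` C"] assms by auto
      then have "c \<in> K n"
        by (auto simp: K_def)
      then show ?thesis by blast
    qed
    show "decseq K"
    proof (rule decseq_SucI)
      fix n
      have "1 / real (Suc (Suc n)) \<le> 1 / real (Suc n)"
        by (simp add: field_simps)
      then show "K (Suc n) \<subseteq> K n"
        unfolding K_def by auto
    qed
    show "bounded (K 0)"
      unfolding K_def by (intro bounded_Int) auto
  qed
  then obtain p where p: "\<And>n. p \<in> K n"
    by blast
  have "dist y p \<le> infdist y C + 1 / Suc n" for n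
    using p[of n] by (simp add: K_def)
  moreover have "(\<lambda>n. infdist y C + 1 / Suc n) \<longlonglongrightarrow> infdist y C + 0"
    by (intro tendsto_intros LIMSEQ_Suc[OF lim_1_over_n])
  ultimately have "dist y p \<le> infdist y C"
    by (intro Lim_bounded2[of "\<lambda>n. infdist y C + 1 / Suc n"]) auto
  moreover have "p \<in> C"
    using p[of 0] by (simp add: K_def)
  ultimately show ?thesis
    using that infdist_le[of p C y] by fastforce
qed

lemma metric_projection_closed_convex:
  fixes C :: "'a::{real_inner, complete_space} set"
  assumes "closed C" "convex C" "C \<noteq> {}"
  shows "metric_projection C y \<in> C" "dist y (metric_projection C y) = infdist y C"
proof -
  have "\<exists>!p. p \<in> C \<and> dist y p = infdist y C"
  proof (rule ex_ex1I)
    show "\<exists>p. p \<in> C \<and> dist y p = infdist y C"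
      using infdist_attained_closed_convex[OF assms] by metis
    show "p = p'" if "p \<in> C \<and> dist y p = infdist y C" "p' \<in> C \<and> dist y p' = infdist y C" for p p'
      using that assms by (intro any_closest_point_unique[of C p p' y]) (auto intro: infdist_le)
  qed
  from theI'[OF this] show "metric_projection C y \<in> C" "dist y (metric_projection C y) = infdist y C"
    unfolding metric_projection_def by auto
qed

lemma closed_subspace_orthogonal_projection:
  fixes V :: "'a::{real_inner, complete_space} set"
  assumes "closed V" "subspace V"
  obtains p where "p \<in> V" "\<And>v. v \<in> V \<Longrightarrow> inner v (y - p) = 0"
proof -
  note V = \<open>closed V\<close> subspace_imp_convex[OF \<open>subspace V\<close>] subspace_0[OF \<open>subspace V\<close>]
  obtain p where p: "p \<in> V" "dist y p = infdist y V"
    using infdist_attained_closed_convex[of V y] V by blast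
  have le: "inner (y - p) v \<le> 0" if "v \<in> V" for v
    using any_closest_point_dot[of V p "p + v" y] that p V subspace_add[OF assms(2) p(1) that]
    by (auto simp: infdist_le)
  have "inner v (y - p) = 0" if "v \<in> V" for v
    using le[OF that] le[OF subspace_neg[OF assms(2) that]] by (simp add: inner_commute)
  then show ?thesis
    using that p(1) by blast
qed

lemma bounded_imp_subsequence_inner_convergent:
  fixes x :: "nat \<Rightarrow> 'a::real_inner"
  assumes "bounded (range x)"
  obtains \<phi> where "strict_mono \<phi>" "\<And>m. convergent (\<lambda>k. inner (x (\<phi> k)) (x m))"
proof -
  obtain R where R: "\<And>k. norm (x k) \<le> R"
    using assms unfolding bounded_iff by blast
  interpret subseqs "\<lambda>m \<phi>. convergent (\<lambda>k. inner (x (\<phi> k)) (x m))"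
  proof
    fix m and \<phi> :: "nat \<Rightarrow> nat"
    have "norm (inner (x (\<phi> k)) (x m)) \<le> R * norm (x m)" for k
      using Cauchy_Schwarz_ineq2[of "x (\<phi> k)" "x m"] mult_right_mono[OF R[of "\<phi> k"], of "norm (x m)"]
      by simp
    then have "bounded (range (\<lambda>k. inner (x (\<phi> k)) (x m)))"
      unfolding bounded_iff by blast
    then obtain l r where "strict_mono (r :: nat \<Rightarrow> nat)" "((\<lambda>k. inner (x (\<phi> k)) (x m)) \<circ> r) \<longlonglongrightarrow> l"
      using bounded_imp_convergent_subsequence by blast
    then show "\<exists>r. strict_mono r \<and> convergent (\<lambda>k. inner (x ((\<phi> \<circ> r) k)) (x m))"
      by (auto simp: o_def convergent_def)
  qed
  have "convergent (\<lambda>k. inner (x (diagseq k)) (x m))" for m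
  proof -
    have "convergent (\<lambda>k. inner (x ((diagseq \<circ> (+) (Suc m)) k)) (x m))"
      by (rule diagseq_holds) (auto simp: o_def dest: convergent_subseq_convergent)
    then show ?thesis
      using convergent_ignore_initial_segment[of "\<lambda>k. inner (x (diagseq k)) (x m)" "Suc m"]
      by (simp add: o_def add.commute)
  qed
  then show ?thesis
    using that subseq_diagseq by blast
qed

text \<open>
  The directions in which the inner products converge form a closed subspace that contains every
  member of the sequence. The part of an arbitrary vector orthogonal to this subspace has inner
  product zero with all members, so it lies in the subspace too, and the subspace is everything.
\<close>

lemma inner_convergent_all_directions:
  fixes x :: "nat \<Rightarrow> 'a::{real_inner, complete_space}"
  assumes bdd: "bounded (range x)" and conv: "\<And>m. convergent (\<lambda>k. inner (x k) (x m))"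
  shows "convergent (\<lambda>k. inner (x k) v)"
proof -
  obtain R where R: "R > 0" "\<And>k. norm (x k) \<le> R"
    using bdd unfolding bounded_pos by blast
  define V where "V = {v. convergent (\<lambda>k. inner (x k) v)}"
  have "subspace V"
    by (auto simp: V_def subspace_def inner_right_distrib
        intro: convergent_add convergent_mult convergent_const)
  moreover have "closed V"
    unfolding closed_sequential_limits
  proof (intro allI impI, elim conjE)
    fix u l assume u: "\<forall>n. u n \<in> V" "u \<longlonglongrightarrow> l"
    have "Cauchy (\<lambda>k. inner (x k) l)"
    proof (rule metric_CauchyI)
      fix e :: real assume "e > 0"
      then obtain n where n: "dist (u n) l < e / (4 * R)"
        using metric_LIMSEQ_D[OF u(2), of "e / (4 * R)"] R(1) by auto
      have "Cauchy (\<lambda>k. inner (x k) (u n))"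
        using u(1) by (auto simp: V_def intro: convergent_Cauchy)
      then obtain N where N: "\<And>j k. j \<ge> N \<Longrightarrow> k \<ge> N \<Longrightarrow> dist (inner (x j) (u n)) (inner (x k) (u n)) < e / 2"
        using \<open>e > 0\<close> unfolding Cauchy_def by (meson half_gt_zero)
      have close: "\<bar>inner (x k) (u n) - inner (x k) l\<bar> < e / 4" for k
      proof -
        have "\<bar>inner (x k) (u n - l)\<bar> \<le> R * dist (u n) l"
          using Cauchy_Schwarz_ineq2[of "x k" "u n - l"]
            mult_right_mono[OF R(2)[of k], of "norm (u n - l)"] by (simp add: dist_norm)
        also have "\<dots> < e / 4"
          using n R(1) by (simp add: field_simps)
        finally show ?thesis
          by (simp add: inner_diff_right)
      qed
      have "dist (inner (x j) l) (inner (x k) l) < e" if "j \<ge> N" "k \<ge> N" for j k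
        using N[OF that] close[of j] close[of k] unfolding dist_real_def by linarith
      then show "\<exists>N. \<forall>j\<ge>N. \<forall>k\<ge>N. dist (inner (x j) l) (inner (x k) l) < e"
        by blast
    qed
    then show "l \<in> V"
      by (simp add: V_def Cauchy_convergent)
  qed
  ultimately obtain p where p: "p \<in> V" "\<And>u. u \<in> V \<Longrightarrow> inner u (v - p) = 0"
    using closed_subspace_orthogonal_projection by blast
  have "inner (x k) (v - p) = 0" for k
    using p(2)[of "x k"] conv[of k] by (simp add: V_def)
  then have "inner (x k) v = inner (x k) p" for k
    by (simp add: inner_diff_right)
  then show ?thesis
    using p(1) by (simp add: V_def)
qed

text \<open>
  Any point common to the closed convex hulls of all tails is the weak limit: for each direction
  \<open>v\<close> a tail of the sequence lies in a thin slab orthogonal to \<open>v\<close>, and so does its closed convex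
  hull. This takes the place of the Riesz representation of the limiting functional.
\<close>

lemma bounded_imp_weakly_convergent_subsequence:
  fixes x :: "nat \<Rightarrow> 'a::{real_inner, complete_space}"
  assumes "bounded (range x)"
  obtains \<phi> l where "strict_mono \<phi>" "weakly_tendsto (x \<circ> \<phi>) l"
proof -
  obtain \<phi> where \<phi>: "strict_mono \<phi>" "\<And>m. convergent (\<lambda>k. inner (x (\<phi> k)) (x m))"
    using bounded_imp_subsequence_inner_convergent[OF assms] by blast
  define u where "u = x \<circ> \<phi>"
  have bdd: "bounded (range u)"
    unfolding u_def using assms by (rule bounded_subset) auto
  have conv: "convergent (\<lambda>k. inner (u k) v)" for v
    using inner_convergent_all_directions[OF bdd] \<phi>(2) by (simp add: u_def)
  define K where "K n = closure (convex hull (u ` {n..}))" for n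
  have "(\<Inter>n. K n) \<noteq> {}"
  proof (rule nested_bounded_closed_convex_Inter_nonempty)
    show "closed (K n)" "convex (K n)" "K n \<noteq> {}" for n
      by (auto simp: K_def convex_closure)
    show "decseq K"
      unfolding K_def decseq_def by (auto intro!: closure_mono hull_mono)
    show "bounded (K 0)"
      unfolding K_def using bounded_closure bounded_convex_hull bdd
      by (metis bounded_subset image_mono subset_UNIV)
  qed
  then obtain l where l: "\<And>n. l \<in> K n"
    by blast
  have "(\<lambda>k. inner (u k) v) \<longlonglongrightarrow> inner l v" for v
  proof -
    obtain c where c: "(\<lambda>k. inner (u k) v) \<longlonglongrightarrow> c"
      using conv[of v] by (auto simp: convergent_def)
    have "\<bar>inner l v - c\<bar> \<le> e" if "e > 0" for e
    proof -
      obtain n where n: "\<And>k. k \<ge> n \<Longrightarrow> \<bar>inner (u k) v - c\<bar> < e"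
        using c \<open>e > 0\<close> unfolding lim_sequentially dist_real_def by blast
      define S where "S = {y. inner v y \<le> c + e} \<inter> {y. inner v y \<ge> c - e}"
      have "K n \<subseteq> S"
        unfolding K_def
      proof (intro closure_minimal hull_minimal)
        show "u ` {n..} \<subseteq> S"
          using n by (force simp: S_def inner_commute[of v] abs_less_iff)
      qed (auto simp: S_def intro: convex_Int convex_halfspace_le convex_halfspace_ge closed_Int
          closed_halfspace_le closed_halfspace_ge)
      then show ?thesis
        using l[of n] by (force simp: S_def inner_commute[of v] abs_le_iff)
    qed
    then have "inner l v = c"
      using field_le_epsilon[of "\<bar>inner l v - c\<bar>" 0] by simp
    then show ?thesis
      using c by simp
  qed
  then show ?thesis
    using that \<phi>(1) by (auto simp: u_def weakly_tendsto_def)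
qed

section \<open>Fejer monotone sequences\<close>

lemma weakly_tendsto_perturb:
  assumes "weakly_tendsto x l" and "(\<lambda>k. y k - x k) \<longlonglongrightarrow> 0"
  shows "weakly_tendsto y l"
  unfolding weakly_tendsto_def
proof
  fix v
  have "(\<lambda>k. inner (x k) v + inner (y k - x k) v) \<longlonglongrightarrow> inner l v + inner 0 v"
    using assms by (intro tendsto_add tendsto_inner[OF assms(2)] tendsto_const) (auto simp: weakly_tendsto_def)
  then show "(\<lambda>k. inner (y k) v) \<longlonglongrightarrow> inner l v"
    by (simp add: inner_diff_left)
qed

text \<open>A ball is an intersection of half-spaces; the one that matters has normal \<open>l - p\<close>.\<close>

lemma weakly_tendsto_in_cball:
  fixes x :: "nat \<Rightarrow> 'a::real_inner"
  assumes "weakly_tendsto x l" and "\<And>k. x k \<in> cball p r"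
  shows "l \<in> cball p r"
proof -
  have "inner (x k - p) (l - p) \<le> r * norm (l - p)" for k
    using norm_cauchy_schwarz[of "x k - p" "l - p"] assms(2)[of k]
      mult_right_mono[of "norm (x k - p)" r "norm (l - p)"]
    by (simp add: dist_norm norm_minus_commute)
  moreover have "(\<lambda>k. inner (x k) (l - p) - inner p (l - p)) \<longlonglongrightarrow> inner l (l - p) - inner p (l - p)"
    using assms(1) by (intro tendsto_diff tendsto_const) (simp add: weakly_tendsto_def)
  ultimately have "inner (l - p) (l - p) \<le> r * norm (l - p)"
    by (intro LIMSEQ_le_const2[of "\<lambda>k. inner (x k) (l - p) - inner p (l - p)"])
      (auto simp: inner_diff_left)
  then have "norm (l - p) * norm (l - p) \<le> r * norm (l - p)"
    by (simp add: dot_square_norm power2_eq_square)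
  moreover have "0 \<le> r"
    using assms(2)[of 0] zero_le_dist[of p "x 0"] by (auto simp del: zero_le_dist)
  ultimately have "norm (l - p) \<le> r"
    by (cases "norm (l - p) = 0") auto
  then show ?thesis
    by (simp add: dist_norm norm_minus_commute)
qed

text \<open>
  Opial's argument: if \<open>y\<close> and \<open>z\<close> in \<open>C\<close> are weak limits of subsequences, the difference of the
  squared distances to \<open>y\<close> and to \<open>z\<close> converges along the whole sequence, and so does the inner product with
  \<open>y - z\<close>. Its limit is the inner product of \<open>y - z\<close> with \<open>y\<close> as well as with \<open>z\<close>, so \<open>y = z\<close>.
\<close>

lemma weakly_convergent_if_weak_cluster_points_in:
  fixes x :: "nat \<Rightarrow> 'a::{real_inner, complete_space}"
  assumes "C \<noteq> {}" and dist: "\<And>z. z \<in> C \<Longrightarrow> convergent (\<lambda>k. dist (x k) z)"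
    and cluster: "\<And>\<phi> l. strict_mono \<phi> \<Longrightarrow> weakly_tendsto (x \<circ> \<phi>) l \<Longrightarrow> l \<in> C"
  obtains l where "l \<in> C" "weakly_tendsto x l"
proof -
  obtain c where "c \<in> C"
    using \<open>C \<noteq> {}\<close> by blast
  obtain R where R: "\<And>k. dist (x k) c \<le> R"
    using convergent_imp_Bseq[OF dist[OF \<open>c \<in> C\<close>]] by (auto simp: Bseq_def)
  have bdd: "bounded (range x)"
    unfolding bounded_def using R by (auto simp: dist_commute intro!: exI[of _ c])
  obtain \<phi> y where y: "strict_mono \<phi>" "weakly_tendsto (x \<circ> \<phi>) y"
    using bounded_imp_weakly_convergent_subsequence[OF bdd] by blast
  have unique: "z = y" if z: "strict_mono \<psi>" "weakly_tendsto (x \<circ> \<psi>) z" for \<psi> z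
  proof -
    have "convergent (\<lambda>k. (dist (x k) z * dist (x k) z - dist (x k) y * dist (x k) y
      + (inner y y - inner z z)) * (1 / 2))"
      using cluster[OF y] cluster[OF z]
      by (intro convergent_mult convergent_diff convergent_add convergent_const dist)
    moreover have "(dist (x k) z * dist (x k) z - dist (x k) y * dist (x k) y
      + (inner y y - inner z z)) * (1 / 2) = inner (x k) (y - z)" for k
      unfolding dist_norm power2_eq_square[symmetric] power2_norm_eq_inner
      by (simp add: algebra_simps inner_commute)
    ultimately obtain a where a: "(\<lambda>k. inner (x k) (y - z)) \<longlonglongrightarrow> a"
      by (auto simp: convergent_def)
    have "inner u (y - z) = a" if "strict_mono \<theta>" "weakly_tendsto (x \<circ> \<theta>) u" for \<theta> u
      using LIMSEQ_unique[OF LIMSEQ_subseq_LIMSEQ[OF a that(1)]] that(2)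
      by (auto simp: weakly_tendsto_def o_def)
    from this[OF y] this[OF z] have "inner (y - z) (y - z) = 0"
      by (simp add: inner_diff_left)
    then show ?thesis
      by simp
  qed
  have "weakly_tendsto x y"
  proof (rule ccontr)
    assume "\<not> weakly_tendsto x y"
    then obtain v where "\<not> (\<lambda>k. inner (x k) v) \<longlonglongrightarrow> inner y v"
      by (auto simp: weakly_tendsto_def)
    then obtain e where e: "e > 0" "infinite {k. \<not> dist (inner (x k) v) (inner y v) < e}"
      by (auto simp: tendsto_iff not_eventually frequently_cofinite cofinite_eq_sequentially[symmetric])
    obtain \<psi> :: "nat \<Rightarrow> nat" where \<psi>: "strict_mono \<psi>" "\<And>k. dist (inner (x (\<psi> k)) v) (inner y v) \<ge> e"
      using infinite_enumerate[OF e(2)] by (auto simp: not_less)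
    have "bounded (range (x \<circ> \<psi>))"
      using bdd by (rule bounded_subset) auto
    then obtain \<theta> z where z: "strict_mono \<theta>" "weakly_tendsto (x \<circ> \<psi> \<circ> \<theta>) z"
      using bounded_imp_weakly_convergent_subsequence by blast
    have "z = y"
      using unique[of "\<psi> \<circ> \<theta>" z] z \<psi>(1) by (simp add: strict_mono_o comp_assoc)
    with z(2) have "(\<lambda>k. inner (x (\<psi> (\<theta> k))) v) \<longlonglongrightarrow> inner y v"
      by (simp add: weakly_tendsto_def)
    then obtain N where "\<forall>k\<ge>N. dist (inner (x (\<psi> (\<theta> k))) v) (inner y v) < e"
      using e(1) metric_LIMSEQ_D by blast
    then have "dist (inner (x (\<psi> (\<theta> N))) v) (inner y v) < e"
      by simp
    then show False
      using \<psi>(2)[of "\<theta> N"] by simp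
  qed
  then show ?thesis
    using that cluster[OF y] by blast
qed

text \<open>
  By monotonicity, a point of \<open>C\<close> that is nearly closest to \<open>x k\<close> is at least as near to \<open>x j\<close>.
\<close>

lemma Fejer_dist_le:
  assumes Fejer: "\<And>z. z \<in> C \<Longrightarrow> decseq (\<lambda>k. dist (x k) z)" and "C \<noteq> {}" and "k \<le> j"
  shows "dist (x j) (x k) \<le> 2 * infdist (x k) C"
proof -
  have "dist (x j) (x k) / 2 \<le> dist (x k) z" if "z \<in> C" for z
    using dist_triangle[of "x j" "x k" z] decseqD[OF Fejer[OF that] \<open>k \<le> j\<close>]
    by (simp add: dist_commute)
  then have "dist (x j) (x k) / 2 \<le> infdist (x k) C"
    unfolding infdist_notempty[OF \<open>C \<noteq> {}\<close>] using \<open>C \<noteq> {}\<close> by (intro cINF_greatest)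
  then show ?thesis
    by simp
qed

lemma Fejer_convergent:
  fixes x :: "nat \<Rightarrow> 'a::complete_space"
  assumes Fejer: "\<And>z. z \<in> C \<Longrightarrow> decseq (\<lambda>k. dist (x k) z)" and C: "C \<noteq> {}" "closed C"
    and lim: "(\<lambda>k. infdist (x k) C) \<longlonglongrightarrow> 0"
  obtains l where "l \<in> C" "x \<longlonglongrightarrow> l"
proof -
  have "Cauchy x"
  proof (rule CauchyI')
    fix e :: real assume "e > 0"
    then have "\<forall>\<^sub>F k in sequentially. infdist (x k) C < e / 2"
      using lim by (intro order_tendstoD) auto
    then obtain N where N: "\<And>k. k \<ge> N \<Longrightarrow> infdist (x k) C < e / 2"
      by (auto simp: eventually_sequentially)
    have "dist (x k) (x j) < e" if "k \<ge> N" "j > k" for j k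
    proof -
      have "dist (x j) (x k) \<le> 2 * infdist (x k) C"
        using Fejer C(1) that(2) by (intro Fejer_dist_le) auto
      then show ?thesis
        using N[OF that(1)] by (simp add: dist_commute)
    qed
    then show "\<exists>N. \<forall>k\<ge>N. \<forall>j>k. dist (x k) (x j) < e"
      by blast
  qed
  then obtain l where l: "x \<longlonglongrightarrow> l"
    using Cauchy_convergent_iff convergent_def by blast
  have "infdist l C = 0"
    using LIMSEQ_unique[OF tendsto_infdist[OF l] lim] .
  then show ?thesis
    using that l C in_closed_iff_infdist_zero by blast
qed

lemma Fejer_limit_dist_le:
  assumes Fejer: "\<And>z. z \<in> C \<Longrightarrow> decseq (\<lambda>k. dist (x k) z)" and "C \<noteq> {}" and "x \<longlonglongrightarrow> l"
  shows "dist (x k) l \<le> 2 * infdist (x k) C"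
proof (rule LIMSEQ_le_const2)
  show "(\<lambda>j. dist (x k) (x j)) \<longlonglongrightarrow> dist (x k) l"
    using assms(3) by (intro tendsto_intros)
  show "\<exists>N. \<forall>j\<ge>N. dist (x k) (x j) \<le> 2 * infdist (x k) C"
    using Fejer_dist_le[of C x k, OF Fejer \<open>C \<noteq> {}\<close>] by (auto simp: dist_commute[of "x k"])
qed

section \<open>Linear regularity implies regularity\<close>

lemma linearly_regular_imp_regular:
  assumes "linearly_regular \<delta> S U"
  shows "regular S U"
  unfolding regular_def
proof (intro allI impI)
  fix x :: "nat \<Rightarrow> 'a"
  assume x: "\<forall>k. x k \<in> S" "(\<lambda>k. norm (U (x k) - x k)) \<longlonglongrightarrow> 0"
  have "infdist (x k) (Fix U) \<le> norm (U (x k) - x k) / \<delta>" for k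
    using assms x(1) by (simp add: linearly_regular_def pos_le_divide_eq mult.commute)
  moreover have "(\<lambda>k. norm (U (x k) - x k) / \<delta>) \<longlonglongrightarrow> 0"
    using tendsto_divide_zero[OF x(2)] .
  ultimately show "(\<lambda>k. infdist (x k) (Fix U)) \<longlonglongrightarrow> 0"
    by (intro Lim_null_comparison[of "\<lambda>k. infdist (x k) (Fix U)"] always_eventually allI)
      (simp_all add: infdist_nonneg)
qed

lemma linearly_regular_family_imp_regular_family:
  assumes "linearly_regular_family \<kappa> S I C"
  shows "regular_family S I C"
  unfolding regular_family_def
proof (intro allI impI)
  fix x :: "nat \<Rightarrow> 'a"
  assume x: "\<forall>k. x k \<in> S" "(\<lambda>k. MAX i\<in>I. infdist (x k) (C i)) \<longlonglongrightarrow> 0"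
  have "infdist (x k) (\<Inter>i\<in>I. C i) \<le> \<kappa> * (MAX i\<in>I. infdist (x k) (C i))" for k
    using assms x(1) unfolding linearly_regular_family_def by blast
  moreover have "(\<lambda>k. \<kappa> * (MAX i\<in>I. infdist (x k) (C i))) \<longlonglongrightarrow> 0"
    using tendsto_mult_right_zero[OF x(2)] .
  ultimately show "(\<lambda>k. infdist (x k) (\<Inter>i\<in>I. C i)) \<longlonglongrightarrow> 0"
    by (intro Lim_null_comparison[of "\<lambda>k. infdist (x k) (\<Inter>i\<in>I. C i)"] always_eventually allI)
      (simp_all add: infdist_nonneg)
qed

section \<open>Cutters and one step of the iteration\<close>

text \<open>
  A point that \<open>U\<close> moves lies outside its own half-space, so the half-spaces leave exactly \<open>Fix U\<close>.
  Closedness and convexity of \<open>Fix U\<close> follow from this.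
\<close>

lemma cutter_Fix_eq_Inter_halfspaces:
  assumes "cutter U"
  shows "Fix U = (\<Inter>y. {z. inner (y - U y) z \<le> inner (y - U y) (U y)})"
proof -
  have "U z = z" if "\<And>y. inner (y - U y) z \<le> inner (y - U y) (U y)" for z
  proof -
    have "inner (z - U z) (z - U z) \<le> 0"
      using that[of z] by (simp add: inner_diff_right)
    then have "inner (z - U z) (z - U z) = 0"
      using inner_ge_zero order_antisym by blast
    then show ?thesis
      by simp
  qed
  moreover have "inner (y - U y) z \<le> inner (y - U y) (U y)" if "z \<in> Fix U" for y z
  proof -
    have "inner (y - U y) (z - U y) \<le> 0"
      using assms that by (simp add: cutter_def inner_commute)
    then show ?thesis
      by (simp add: inner_diff_right)
  qed
  ultimately show ?thesis
    unfolding Fix_def by blast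
qed

lemma cutter_imp_closed_convex_Fix:
  assumes "cutter U"
  shows "closed (Fix U)" "convex (Fix U)"
  unfolding cutter_Fix_eq_Inter_halfspaces[OF assms]
  by (intro closed_INT convex_INT ballI closed_halfspace_le convex_halfspace_le)+

lemma cutter_inner_ge:
  assumes "cutter U" "z \<in> Fix U"
  shows "(norm (U y - y))\<^sup>2 \<le> inner (z - y) (U y - y)"
proof -
  have "inner (z - U y) (y - U y) \<le> 0"
    using assms by (simp add: cutter_def)
  then show ?thesis
    by (simp add: power2_norm_eq_inner algebra_simps inner_commute)
qed

lemma cutter_residual_le_dist:
  assumes "cutter U" "z \<in> Fix U"
  shows "norm (U y - y) \<le> dist y z"
proof (cases "U y = y")
  case False
  have "norm (U y - y) * norm (U y - y) \<le> norm (z - y) * norm (U y - y)"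
    using cutter_inner_ge[OF assms, of y] norm_cauchy_schwarz[of "z - y" "U y - y"]
    by (simp add: power2_eq_square)
  then show ?thesis
    using False by (simp add: dist_norm norm_minus_commute)
qed simp

text \<open>
  With \<open>v = (\<Sum>i\<in>J. w i *\<^sub>R (U i y - y))\<close> and \<open>S = (\<Sum>i\<in>J. w i * (norm (U i y - y))\<^sup>2)\<close> the step is
  \<open>y' = y + (\<lambda> * \<sigma>) *\<^sub>R v\<close>. The cutter inequalities add up to \<open>S \<le> inner (z - y) v\<close>, and the
  extrapolation bound says precisely that \<open>\<sigma> * (norm v)\<^sup>2 \<le> S\<close>. Expanding \<open>(dist y' z)\<^sup>2\<close>
  then gives the first bound; the second one is the estimate of \<open>(norm v)\<^sup>2\<close> again.
\<close>

lemma extrapolated_step_descent: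
  fixes U :: "'i \<Rightarrow> 'a \<Rightarrow> 'a::real_inner"
  assumes cutters: "\<And>i. i \<in> J \<Longrightarrow> cutter (U i)" and z: "\<And>i. i \<in> J \<Longrightarrow> z \<in> Fix (U i)"
    and w: "\<And>i. i \<in> J \<Longrightarrow> w i \<ge> 0" "(\<Sum>i\<in>J. w i) = 1"
    and t: "0 < t" and \<sigma>: "\<sigma> \<in> {1..extrapolation_bound J w U y}"
    and y': "y' = y + (t * \<sigma>) *\<^sub>R ((\<Sum>i\<in>J. w i *\<^sub>R U i y) - y)"
  defines "S \<equiv> \<Sum>i\<in>J. w i * (norm (U i y - y))\<^sup>2"
  shows "t * (2 - t) * \<sigma> * S \<le> (dist y z)\<^sup>2 - (dist y' z)\<^sup>2"
    and "(dist y' y)\<^sup>2 \<le> t\<^sup>2 * \<sigma> * S"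
proof -
  define v where "v = (\<Sum>i\<in>J. w i *\<^sub>R U i y) - y"
  have v: "v = (\<Sum>i\<in>J. w i *\<^sub>R (U i y - y))"
    using w(2) by (simp add: v_def scaleR_diff_right sum_subtractf flip: scaleR_sum_left)
  have "1 \<le> \<sigma>" using \<sigma> by simp
  have "S \<ge> 0"
    unfolding S_def by (intro sum_nonneg mult_nonneg_nonneg w) auto
  have "S \<le> (\<Sum>i\<in>J. w i * inner (z - y) (U i y - y))"
    unfolding S_def by (intro sum_mono mult_left_mono cutter_inner_ge cutters z w)
  then have inner_ge: "S \<le> inner (z - y) v"
    by (simp add: v inner_sum_right)
  have bound: "\<sigma> * (norm v)\<^sup>2 \<le> S"
  proof (cases "y \<in> (\<Inter>i\<in>J. Fix (U i))")
    case True
    then have "v = 0"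
      by (auto simp: v Fix_def intro!: sum.neutral)
    then show ?thesis
      using \<open>S \<ge> 0\<close> by simp
  next
    case False
    then have "\<sigma> \<le> S / (norm v)\<^sup>2"
      using \<sigma> by (simp add: extrapolation_bound_def S_def v_def)
    then show ?thesis
      using \<open>S \<ge> 0\<close> by (cases "v = 0") (auto simp: field_simps)
  qed
  have step: "y' = y + (t * \<sigma>) *\<^sub>R v"
    using y' by (simp add: v_def)
  have "(dist y z)\<^sup>2 - (dist y' z)\<^sup>2
      = 2 * (t * \<sigma>) * inner (z - y) v - t\<^sup>2 * \<sigma> * (\<sigma> * (norm v)\<^sup>2)"
    unfolding step dist_norm power2_norm_eq_inner
    by (simp add: algebra_simps inner_commute power2_eq_square)
  also have "\<dots> \<ge> 2 * (t * \<sigma>) * S - t\<^sup>2 * \<sigma> * S"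
    using inner_ge bound \<open>1 \<le> \<sigma>\<close> t by (intro diff_mono mult_left_mono) auto
  finally show "t * (2 - t) * \<sigma> * S \<le> (dist y z)\<^sup>2 - (dist y' z)\<^sup>2"
    by (simp add: algebra_simps power2_eq_square)
  have "(dist y' y)\<^sup>2 = t\<^sup>2 * \<sigma> * (\<sigma> * (norm v)\<^sup>2)"
    by (simp add: step dist_norm power_mult_distrib power2_eq_square)
  also have "\<dots> \<le> t\<^sup>2 * \<sigma> * S"
    using bound \<open>1 \<le> \<sigma>\<close> by (intro mult_left_mono) auto
  finally show "(dist y' y)\<^sup>2 \<le> t\<^sup>2 * \<sigma> * S" .
qed

section \<open>Intermittent descent towards the common fixed points\<close>

text \<open>
  The convergence arguments use the iteration only through two inequalities: the decrease of the
  squared distance to a common fixed point dominates the squared step length and the squared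
  residual of every active operator.
\<close>

locale intermittent_descent =
  fixes U :: "'i \<Rightarrow> 'a \<Rightarrow> 'a::{real_inner, complete_space}"
    and I :: "'i set" and J :: "nat \<Rightarrow> 'i set" and x :: "nat \<Rightarrow> 'a" and s :: nat
    and \<rho> \<theta> :: real
  assumes finite_I: "finite I" and I_nonempty: "I \<noteq> {}"
    and cutters: "i \<in> I \<Longrightarrow> cutter (U i)"
    and C_nonempty: "(\<Inter>i\<in>I. Fix (U i)) \<noteq> {}"
    and intermittent: "intermittent s I J"
    and \<rho>: "\<rho> > 0" and \<theta>: "\<theta> > 0"
    and step_descent: "z \<in> (\<Inter>i\<in>I. Fix (U i)) \<Longrightarrow>
      \<rho> * (dist (x (Suc k)) (x k))\<^sup>2 \<le> (dist (x k) z)\<^sup>2 - (dist (x (Suc k)) z)\<^sup>2"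
    and residual_descent: "z \<in> (\<Inter>i\<in>I. Fix (U i)) \<Longrightarrow> i \<in> J k \<Longrightarrow>
      \<theta> * (norm (U i (x k) - x k))\<^sup>2 \<le> (dist (x k) z)\<^sup>2 - (dist (x (Suc k)) z)\<^sup>2"
begin

abbreviation C :: "'a set" where
  "C \<equiv> \<Inter>i\<in>I. Fix (U i)"

abbreviation B :: "'a set" where
  "B \<equiv> cball (metric_projection C (x 0)) (infdist (x 0) C)"

lemma closed_convex_C: "closed C" "convex C"
  using cutter_imp_closed_convex_Fix[OF cutters] by (blast intro: closed_INT convex_INT)+

lemma projection: "metric_projection C y \<in> C" "dist y (metric_projection C y) = infdist y C"
  by (rule metric_projection_closed_convex[OF closed_convex_C C_nonempty])+

lemma Fejer: "z \<in> C \<Longrightarrow> decseq (\<lambda>k. dist (x k) z)"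
proof (rule decseq_SucI)
  fix k assume "z \<in> C"
  have "0 \<le> \<rho> * (dist (x (Suc k)) (x k))\<^sup>2"
    using \<rho> by simp
  also have "\<dots> \<le> (dist (x k) z)\<^sup>2 - (dist (x (Suc k)) z)\<^sup>2"
    using \<open>z \<in> C\<close> by (rule step_descent)
  finally have "(dist (x (Suc k)) z)\<^sup>2 \<le> (dist (x k) z)\<^sup>2"
    by simp
  then show "dist (x (Suc k)) z \<le> dist (x k) z"
    by (rule power2_le_imp_le) simp
qed

lemma dist_convergent: "z \<in> C \<Longrightarrow> convergent (\<lambda>k. dist (x k) z)"
proof -
  assume "z \<in> C"
  obtain a where "(\<lambda>k. dist (x k) z) \<longlonglongrightarrow> a"
    using decseq_convergent[OF Fejer[OF \<open>z \<in> C\<close>], of 0] zero_le_dist by blast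
  then show ?thesis
    unfolding convergent_def by blast
qed

lemma iterates_in_B: "x k \<in> B"
  using decseqD[OF Fejer[OF projection(1)[of "x 0"]], of 0 k]
  unfolding projection(2) mem_cball dist_commute[of _ "x k"] by blast

lemma decrease_tendsto_0:
  assumes "z \<in> C"
  shows "(\<lambda>k. (dist (x k) z)\<^sup>2 - (dist (x (Suc k)) z)\<^sup>2) \<longlonglongrightarrow> 0"
proof -
  obtain a where "(\<lambda>k. dist (x k) z) \<longlonglongrightarrow> a"
    using dist_convergent[OF assms] by (auto simp: convergent_def)
  from tendsto_diff[OF tendsto_power[OF this, of 2] tendsto_power[OF LIMSEQ_Suc[OF this], of 2]]
  show ?thesis
    by (simp only: diff_self)
qed

lemma steps_tendsto_0: "(\<lambda>k. dist (x (Suc k)) (x k)) \<longlonglongrightarrow> 0"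
proof -
  obtain z where z: "z \<in> C"
    using C_nonempty by blast
  have "(\<lambda>k. \<rho> * (dist (x (Suc k)) (x k))\<^sup>2) \<longlonglongrightarrow> 0"
  proof (rule tendsto_sandwich[OF _ _ tendsto_const decrease_tendsto_0[OF z]])
    show "\<forall>\<^sub>F k in sequentially. 0 \<le> \<rho> * (dist (x (Suc k)) (x k))\<^sup>2"
      using \<rho> by simp
    show "\<forall>\<^sub>F k in sequentially. \<rho> * (dist (x (Suc k)) (x k))\<^sup>2 \<le> (dist (x k) z)\<^sup>2 - (dist (x (Suc k)) z)\<^sup>2"
      using step_descent[OF z] by (intro always_eventually allI)
  qed
  from tendsto_mult_left[OF this, of "1 / \<rho>"]
  have "(\<lambda>k. (dist (x (Suc k)) (x k))\<^sup>2) \<longlonglongrightarrow> 0"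
    using \<rho> by simp
  from tendsto_real_sqrt[OF this] show ?thesis
    by simp
qed

lemma dist_le_sum_steps:
  assumes "k \<le> m"
  shows "dist (x m) (x k) \<le> (\<Sum>j\<in>{k..<m}. dist (x (Suc j)) (x j))"
  using assms
proof (induction rule: dec_induct)
  case (step m)
  then show ?case
    using dist_triangle[of "x (Suc m)" "x k" "x m"] by simp
qed simp

text \<open>
  Within each block of \<open>s\<close> consecutive indices, pick one at which \<open>U i\<close> is active: there the
  residual is controlled, and the iterate differs from the first one of the block by at most \<open>s\<close>
  steps of vanishing length.
\<close>

lemma activation_times:
  assumes "i \<in> I"
  obtains m where "(\<lambda>k. x (m k) - x k) \<longlonglongrightarrow> 0" "(\<lambda>k. U i (x (m k)) - x (m k)) \<longlonglongrightarrow> 0"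
proof -
  have "\<exists>m. m \<in> {k..<k + s} \<and> i \<in> J m" for k
    using intermittent assms unfolding intermittent_def by blast
  then obtain m where m: "\<And>k. m k \<in> {k..<k + s}" "\<And>k. i \<in> J (m k)"
    by metis
  have "(\<lambda>k. \<Sum>j<s. dist (x (Suc (j + k))) (x (j + k))) \<longlonglongrightarrow> (\<Sum>j<s. 0)"
    using LIMSEQ_ignore_initial_segment[OF steps_tendsto_0]
    by (intro tendsto_sum) (simp add: add.commute)
  moreover have "norm (x (m k) - x k) \<le> (\<Sum>j<s. dist (x (Suc (j + k))) (x (j + k)))" for k
  proof -
    have "dist (x (m k)) (x k) \<le> (\<Sum>j\<in>{k..<m k}. dist (x (Suc j)) (x j))"
      using m(1)[of k] by (intro dist_le_sum_steps) auto
    also have "\<dots> \<le> (\<Sum>j\<in>{k..<k + s}. dist (x (Suc j)) (x j))"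
      using m(1)[of k] by (intro sum_mono2) auto
    also have "\<dots> = (\<Sum>j<s. dist (x (Suc (j + k))) (x (j + k)))"
      using sum.shift_bounds_nat_ivl[of "\<lambda>j. dist (x (Suc j)) (x j)" 0 k s]
      by (simp add: add.commute atLeast0LessThan)
    finally show ?thesis
      by (simp add: dist_norm)
  qed
  ultimately have close: "(\<lambda>k. x (m k) - x k) \<longlonglongrightarrow> 0"
    by (intro Lim_null_comparison[of "\<lambda>k. x (m k) - x k"] always_eventually allI) simp_all
  obtain z where z: "z \<in> C"
    using C_nonempty by blast
  have "filterlim m at_top sequentially"
    using m(1) by (intro filterlim_at_top_mono[OF filterlim_ident]) auto
  note decrease = filterlim_compose[OF decrease_tendsto_0[OF z] this]
  have "(\<lambda>k. \<theta> * (norm (U i (x (m k)) - x (m k)))\<^sup>2) \<longlonglongrightarrow> 0"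
  proof (rule tendsto_sandwich[OF _ _ tendsto_const decrease])
    show "\<forall>\<^sub>F k in sequentially. 0 \<le> \<theta> * (norm (U i (x (m k)) - x (m k)))\<^sup>2"
      using \<theta> by simp
    show "\<forall>\<^sub>F k in sequentially. \<theta> * (norm (U i (x (m k)) - x (m k)))\<^sup>2
        \<le> (dist (x (m k)) z)\<^sup>2 - (dist (x (Suc (m k))) z)\<^sup>2"
      using residual_descent[OF z m(2)] by (intro always_eventually allI)
  qed
  from tendsto_mult_left[OF this, of "1 / \<theta>"]
  have "(\<lambda>k. (norm (U i (x (m k)) - x (m k)))\<^sup>2) \<longlonglongrightarrow> 0"
    using \<theta> by simp
  from tendsto_real_sqrt[OF this] have "(\<lambda>k. norm (U i (x (m k)) - x (m k))) \<longlonglongrightarrow> 0"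
    by simp
  then have "(\<lambda>k. U i (x (m k)) - x (m k)) \<longlonglongrightarrow> 0"
    by (rule tendsto_norm_zero_cancel)
  with close show ?thesis
    using that by blast
qed

lemma weak_convergence:
  assumes regular: "\<And>i. i \<in> I \<Longrightarrow> weakly_regular B (U i)"
  obtains l where "l \<in> C \<inter> B" "weakly_tendsto x l"
proof -
  have "l \<in> C" if l: "strict_mono \<phi>" "weakly_tendsto (x \<circ> \<phi>) l" for \<phi> l
  proof
    fix i assume "i \<in> I"
    then obtain m where m: "(\<lambda>k. x (m k) - x k) \<longlonglongrightarrow> 0" "(\<lambda>k. U i (x (m k)) - x (m k)) \<longlonglongrightarrow> 0"
      using activation_times by blast
    define y where "y k = x (m (\<phi> k))" for k
    have "(\<lambda>k. y k - (x \<circ> \<phi>) k) \<longlonglongrightarrow> 0"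
      using LIMSEQ_subseq_LIMSEQ[OF m(1) l(1)] by (simp add: y_def o_def)
    then have "weakly_tendsto y l"
      using weakly_tendsto_perturb[OF l(2)] by blast
    moreover have "(\<lambda>k. U i (y k) - y k) \<longlonglongrightarrow> 0"
      using LIMSEQ_subseq_LIMSEQ[OF m(2) l(1)] by (simp add: y_def o_def)
    ultimately show "l \<in> Fix (U i)"
      using regular[OF \<open>i \<in> I\<close>, unfolded weakly_regular_def, rule_format, of y l] iterates_in_B
      unfolding y_def by blast
  qed
  then obtain l where l: "l \<in> C" "weakly_tendsto x l"
    using weakly_convergent_if_weak_cluster_points_in[OF C_nonempty dist_convergent] by blast
  then show ?thesis
    using that weakly_tendsto_in_cball[OF l(2) iterates_in_B] by blast
qed

lemma strong_convergence:
  assumes regular: "\<And>i. i \<in> I \<Longrightarrow> regular B (U i)"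
    and family: "regular_family B I (\<lambda>i. Fix (U i))"
  obtains l where "l \<in> C \<inter> B" "x \<longlonglongrightarrow> l"
proof -
  have lim: "(\<lambda>k. infdist (x k) (Fix (U i))) \<longlonglongrightarrow> 0" if "i \<in> I" for i
  proof -
    obtain m where m: "(\<lambda>k. x (m k) - x k) \<longlonglongrightarrow> 0" "(\<lambda>k. U i (x (m k)) - x (m k)) \<longlonglongrightarrow> 0"
      using activation_times \<open>i \<in> I\<close> by blast
    have "(\<lambda>k. infdist (x (m k)) (Fix (U i))) \<longlonglongrightarrow> 0"
      using regular[OF \<open>i \<in> I\<close>, unfolded regular_def, rule_format, of "\<lambda>k. x (m k)"]
        iterates_in_B tendsto_norm_zero[OF m(2)] by simp
    then have "(\<lambda>k. infdist (x (m k)) (Fix (U i)) + norm (x (m k) - x k)) \<longlonglongrightarrow> 0 + 0"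
      by (intro tendsto_add tendsto_norm_zero m(1))
    moreover have "infdist (x k) (Fix (U i)) \<le> infdist (x (m k)) (Fix (U i)) + norm (x (m k) - x k)" for k
      using infdist_triangle[of "x k" "Fix (U i)" "x (m k)"] by (simp add: dist_norm norm_minus_commute)
    ultimately show ?thesis
      by (intro Lim_null_comparison[of "\<lambda>k. infdist (x k) (Fix (U i))"] always_eventually allI)
        (simp_all add: infdist_nonneg)
  qed
  have "(\<lambda>k. MAX i\<in>I. infdist (x k) (Fix (U i))) \<longlonglongrightarrow> 0"
  proof (rule tendstoI)
    fix e :: real assume "e > 0"
    have "\<forall>\<^sub>F k in sequentially. \<forall>i\<in>I. infdist (x k) (Fix (U i)) < e"
      using finite_I order_tendstoD(2)[OF lim \<open>e > 0\<close>] by (intro eventually_ball_finite) auto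
    then show "\<forall>\<^sub>F k in sequentially. dist (MAX i\<in>I. infdist (x k) (Fix (U i))) 0 < e"
    proof eventually_elim
      case (elim k)
      obtain i where "i \<in> I"
        using I_nonempty by blast
      then have "infdist (x k) (Fix (U i)) \<le> (MAX i\<in>I. infdist (x k) (Fix (U i)))"
        using finite_I by (intro Max_ge) auto
      then have "0 \<le> (MAX i\<in>I. infdist (x k) (Fix (U i)))"
        by (rule order_trans[OF infdist_nonneg])
      moreover have "(MAX i\<in>I. infdist (x k) (Fix (U i))) < e"
        using elim finite_I I_nonempty by (subst Max_less_iff) auto
      ultimately show ?case
        by simp
    qed
  qed
  then have "(\<lambda>k. infdist (x k) C) \<longlonglongrightarrow> 0"
    using family[unfolded regular_family_def, rule_format, of x] iterates_in_B by blast
  then obtain l where l: "l \<in> C" "x \<longlonglongrightarrow> l"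
    using Fejer_convergent[OF Fejer C_nonempty closed_convex_C(1)] by blast
  then show ?thesis
    using that closed_sequentially[OF closed_cball iterates_in_B l(2)] by blast
qed

lemma dist_limit_le: "x \<longlonglongrightarrow> l \<Longrightarrow> dist (x k) l \<le> 2 * infdist (x k) C"
  using Fejer_limit_dist_le[OF Fejer C_nonempty] by blast

text \<open>
  Going from \<open>x k\<close> to an iterate \<open>x m\<close> of the block at which \<open>U i\<close> is active and on to \<open>Fix (U i)\<close>
  takes at most \<open>s\<close> legs, namely the steps in between and the residual divided by \<open>d\<close>. The bounds on
  \<open>\<mu>\<close> make \<open>\<mu>\<close> times the square of each leg at most the decrease at its own index, so Cauchy-Schwarz
  and telescoping bound the squared distance by the total decrease over the block.
\<close>

lemma block_decrease:
  assumes "i \<in> I" "z \<in> C" and \<mu>: "0 \<le> \<mu>" "\<mu> \<le> \<rho>" "\<mu> \<le> \<theta> * d\<^sup>2" and "d > 0"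
    and regular: "\<And>y. y \<in> B \<Longrightarrow> d * infdist y (Fix (U i)) \<le> norm (U i y - y)"
  shows "\<mu> * (infdist (x k) (Fix (U i)))\<^sup>2 \<le> real s * ((dist (x k) z)\<^sup>2 - (dist (x (k + s)) z)\<^sup>2)"
proof -
  have "i \<in> (\<Union>l\<in>{k..<k + s}. J l)"
    using intermittent \<open>i \<in> I\<close> unfolding intermittent_def by blast
  then obtain m where m: "k \<le> m" "m < k + s" "i \<in> J m"
    by auto
  define D where "D j = (dist (x j) z)\<^sup>2" for j
  define leg where "leg j = (if j = m then norm (U i (x m) - x m) / d else dist (x (Suc j)) (x j))" for j
  have D_mono: "D j \<le> D n" if "n \<le> j" for n j
    unfolding D_def by (rule power_mono[OF decseqD[OF Fejer[OF \<open>z \<in> C\<close>] that] zero_le_dist])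
  have leg: "\<mu> * (leg j)\<^sup>2 \<le> D j - D (Suc j)" for j
  proof (cases "j = m")
    case True
    have "\<mu> * (leg j)\<^sup>2 \<le> \<theta> * d\<^sup>2 * (leg j)\<^sup>2"
      using \<mu>(3) by (intro mult_right_mono) auto
    also have "\<dots> = \<theta> * (norm (U i (x m) - x m))\<^sup>2"
      using True \<open>d > 0\<close> by (simp add: leg_def power_divide)
    also have "\<dots> \<le> D j - D (Suc j)"
      using residual_descent[OF \<open>z \<in> C\<close> m(3)] True by (simp add: D_def)
    finally show ?thesis .
  next
    case False
    then have "\<mu> * (leg j)\<^sup>2 \<le> \<rho> * (dist (x (Suc j)) (x j))\<^sup>2"
      using \<mu>(2) by (auto simp: leg_def intro: mult_right_mono)
    also have "\<dots> \<le> D j - D (Suc j)"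
      using step_descent[OF \<open>z \<in> C\<close>] by (simp add: D_def)
    finally show ?thesis .
  qed
  have "infdist (x k) (Fix (U i)) \<le> dist (x m) (x k) + infdist (x m) (Fix (U i))"
    using infdist_triangle[of "x k" "Fix (U i)" "x m"] by (simp add: dist_commute)
  also have "\<dots> \<le> (\<Sum>j\<in>{k..<m}. leg j) + leg m"
  proof (rule add_mono)
    have "(\<Sum>j\<in>{k..<m}. leg j) = (\<Sum>j\<in>{k..<m}. dist (x (Suc j)) (x j))"
      by (intro sum.cong) (auto simp: leg_def)
    then show "dist (x m) (x k) \<le> (\<Sum>j\<in>{k..<m}. leg j)"
      using dist_le_sum_steps[OF m(1)] by simp
    show "infdist (x m) (Fix (U i)) \<le> leg m"
      using regular[OF iterates_in_B[of m]] \<open>d > 0\<close> by (simp add: leg_def field_simps)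
  qed
  also have "\<dots> = (\<Sum>j\<in>{k..<Suc m}. leg j)"
    using m(1) by simp
  finally have "(infdist (x k) (Fix (U i)))\<^sup>2 \<le> (\<Sum>j\<in>{k..<Suc m}. leg j)\<^sup>2"
    using infdist_nonneg by (rule power_mono)
  also have "\<dots> \<le> (\<Sum>j\<in>{k..<Suc m}. (leg j)\<^sup>2) * card {k..<Suc m}"
    by (rule sum_squared_le_sum_of_squares)
  also have "\<dots> \<le> (\<Sum>j\<in>{k..<Suc m}. (leg j)\<^sup>2) * real s"
    using m by (intro mult_left_mono sum_nonneg) auto
  finally have "\<mu> * (infdist (x k) (Fix (U i)))\<^sup>2 \<le> \<mu> * ((\<Sum>j\<in>{k..<Suc m}. (leg j)\<^sup>2) * real s)"
    using \<mu>(1) by (rule mult_left_mono)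
  also have "\<dots> = (\<Sum>j\<in>{k..<Suc m}. \<mu> * (leg j)\<^sup>2) * real s"
    by (simp only: mult.assoc flip: sum_distrib_left)
  also have "\<dots> \<le> (\<Sum>j\<in>{k..<Suc m}. D j - D (Suc j)) * real s"
    by (intro mult_right_mono sum_mono leg) auto
  also have "\<dots> = (D k - D (Suc m)) * real s"
    using m(1) sum_Suc_diff'[of k "Suc m" "\<lambda>j. - D j"] by simp
  also have "\<dots> \<le> (D k - D (k + s)) * real s"
    using m(2) by (intro mult_right_mono diff_left_mono D_mono) auto
  finally show ?thesis
    by (simp add: D_def mult.commute)
qed

text \<open>
  Applied with \<open>z\<close> the projection of \<open>x k\<close> and with the \<open>i\<close> whose fixed point set is farthest away, the
  block decrease is a fixed fraction of \<open>(infdist (x k) C)\<^sup>2\<close>.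
\<close>

lemma block_contraction:
  assumes "s \<ge> 1" and regular: "\<And>i. i \<in> I \<Longrightarrow> linearly_regular (\<delta> i) B (U i)"
    and d: "d > 0" "\<And>i. i \<in> I \<Longrightarrow> d \<le> \<delta> i"
    and family: "linearly_regular_family \<kappa> B I (\<lambda>i. Fix (U i))"
    and \<mu>: "0 \<le> \<mu>" "\<mu> \<le> \<rho>" "\<mu> \<le> \<theta> * d\<^sup>2"
  shows "(infdist (x (k + s)) C)\<^sup>2 \<le> (1 - \<mu> / (real s * \<kappa>\<^sup>2)) * (infdist (x k) C)\<^sup>2"
proof -
  have "\<kappa> > 0" using family by (simp add: linearly_regular_family_def)
  define z where "z = metric_projection C (x k)"
  have z: "z \<in> C" "dist (x k) z = infdist (x k) C"
    unfolding z_def by (rule projection)+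
  have "(MAX i\<in>I. infdist (x k) (Fix (U i))) \<in> (\<lambda>i. infdist (x k) (Fix (U i))) ` I"
    using finite_I I_nonempty by (intro Max_in) auto
  then obtain i where i: "i \<in> I" "(MAX i\<in>I. infdist (x k) (Fix (U i))) = infdist (x k) (Fix (U i))"
    by blast
  have "d * infdist y (Fix (U i)) \<le> norm (U i y - y)" if "y \<in> B" for y
  proof -
    have "d * infdist y (Fix (U i)) \<le> \<delta> i * infdist y (Fix (U i))"
      using d(2)[OF i(1)] infdist_nonneg by (rule mult_right_mono)
    also have "\<dots> \<le> norm (U i y - y)"
      using regular[OF i(1)] that by (simp add: linearly_regular_def)
    finally show ?thesis .
  qed
  from block_decrease[OF i(1) z(1) \<mu> d(1) this, of k]
  have decrease: "\<mu> * (infdist (x k) (Fix (U i)))\<^sup>2 \<le> real s * ((infdist (x k) C)\<^sup>2 - (dist (x (k + s)) z)\<^sup>2)"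
    by (simp add: z(2))
  have "infdist (x k) C \<le> \<kappa> * infdist (x k) (Fix (U i))"
    using family iterates_in_B[of k] unfolding linearly_regular_family_def i(2)[symmetric] by blast
  then have "(infdist (x k) C)\<^sup>2 \<le> (\<kappa> * infdist (x k) (Fix (U i)))\<^sup>2"
    using infdist_nonneg by (rule power_mono)
  then have "\<mu> * (infdist (x k) C)\<^sup>2 \<le> \<mu> * (\<kappa> * infdist (x k) (Fix (U i)))\<^sup>2"
    using \<mu>(1) by (rule mult_left_mono)
  also have "\<dots> = \<kappa>\<^sup>2 * (\<mu> * (infdist (x k) (Fix (U i)))\<^sup>2)"
    by (simp only: power_mult_distrib mult.left_commute)
  also have "\<dots> \<le> \<kappa>\<^sup>2 * (real s * ((infdist (x k) C)\<^sup>2 - (dist (x (k + s)) z)\<^sup>2))"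
    by (intro mult_left_mono decrease) auto
  finally have "\<mu> / (real s * \<kappa>\<^sup>2) * (infdist (x k) C)\<^sup>2 \<le> (infdist (x k) C)\<^sup>2 - (dist (x (k + s)) z)\<^sup>2"
    using \<open>s \<ge> 1\<close> \<open>\<kappa> > 0\<close> by (simp add: pos_divide_le_eq mult_ac)
  moreover have "(infdist (x (k + s)) C)\<^sup>2 \<le> (dist (x (k + s)) z)\<^sup>2"
    by (rule power_mono[OF infdist_le[OF z(1)] infdist_nonneg])
  ultimately show ?thesis
    by (simp add: algebra_simps)
qed

end

section \<open>Geometric decay\<close>

text \<open>
  With \<open>t\<close> the root of \<open>q\<close>, each block contributes \<open>t ^ s\<close>, and only complete blocks count, which costs
  up to \<open>s - 1\<close> in the exponent. For \<open>k < s - 1\<close> the exponent is negative, and the bound is at least \<open>a 0\<close> provided that the base is not zero: a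
  negative power of zero is zero by convention, whence the alternative \<open>q > 0 \<or> s = 1\<close>.
\<close>

lemma block_contraction_imp_geometric_decay:
  fixes a :: "nat \<Rightarrow> real"
  assumes nonneg: "\<And>k. 0 \<le> a k" and "decseq a" and "s \<ge> 1"
    and q: "0 \<le> q" "q \<le> 1" "q > 0 \<or> s = 1"
    and contraction: "\<And>k. (a (k + s))\<^sup>2 \<le> q * (a k)\<^sup>2"
  shows "a k \<le> a 0 * root (2 * s) q powi (int k - int s + 1)"
proof -
  define t where "t = root (2 * s) q"
  have t: "0 \<le> t" "t \<le> 1" "t ^ (2 * s) = q"
    using q \<open>s \<ge> 1\<close> by (auto simp: t_def)
  have block: "a (k + s) \<le> t ^ s * a k" for k
  proof (rule power2_le_imp_le)
    show "(a (k + s))\<^sup>2 \<le> (t ^ s * a k)\<^sup>2"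
      using contraction[of k] t(3) by (simp add: power_mult_distrib mult.commute flip: power_mult)
    show "0 \<le> t ^ s * a k"
      using t(1) nonneg by simp
  qed
  have blocks: "a (n * s) \<le> t ^ (n * s) * a 0" for n
  proof (induction n)
    case (Suc n)
    have "a (Suc n * s) \<le> t ^ s * a (n * s)"
      using block[of "n * s"] by (simp add: add.commute)
    also have "\<dots> \<le> t ^ s * (t ^ (n * s) * a 0)"
      using Suc t(1) by (intro mult_left_mono) auto
    finally show ?case
      by (simp add: power_add)
  qed simp
  have "a k \<le> a 0 * t powi (int k - int s + 1)"
  proof (cases "s \<le> k + 1")
    case True
    have "k + 1 - s \<le> k div s * s"
      using div_mult_mod_eq[of k s] mod_less_divisor[of s k] \<open>s \<ge> 1\<close> by linarith
    then have "t ^ (k div s * s) \<le> t ^ (k + 1 - s)"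
      using t(1,2) by (rule power_decreasing)
    have "a k \<le> a (k div s * s)"
      by (rule decseqD[OF \<open>decseq a\<close>]) simp
    also have "\<dots> \<le> t ^ (k div s * s) * a 0"
      by (rule blocks)
    also have "\<dots> \<le> t ^ (k + 1 - s) * a 0"
      using \<open>t ^ (k div s * s) \<le> t ^ (k + 1 - s)\<close> nonneg by (rule mult_right_mono)
    also have "t ^ (k + 1 - s) = t powi (int k - int s + 1)"
      using True power_int_of_nat[of t "k + 1 - s"] by (simp add: of_nat_diff algebra_simps)
    finally show ?thesis
      by (simp add: mult.commute)
  next
    case False
    then have "t > 0"
      using q(3) \<open>s \<ge> 1\<close> by (simp add: t_def)
    have "int k - int s + 1 = - int (s - 1 - k)"
      using False by simp
    then have "t powi (int k - int s + 1) = inverse (t ^ (s - 1 - k))"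
      by (simp only: power_int_minus power_int_of_nat)
    moreover have "1 \<le> inverse (t ^ (s - 1 - k))"
      using t \<open>t > 0\<close> by (intro one_le_inverse power_le_one) auto
    ultimately have "a 0 \<le> a 0 * t powi (int k - int s + 1)"
      using mult_left_mono[of 1 _ "a 0"] nonneg[of 0] by simp
    then show ?thesis
      using decseqD[OF \<open>decseq a\<close>, of 0 k] by simp
  qed
  then show ?thesis
    by (simp add: t_def)
qed

context intermittent_descent
begin

lemma infdist_decseq: "decseq (\<lambda>k. infdist (x k) C)"
proof (rule decseq_SucI)
  fix k
  have "infdist (x (Suc k)) C \<le> dist (x (Suc k)) (metric_projection C (x k))"
    by (rule infdist_le[OF projection(1)])
  also have "\<dots> \<le> dist (x k) (metric_projection C (x k))"
    by (rule decseq_SucD[OF Fejer[OF projection(1)]])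
  finally show "infdist (x (Suc k)) C \<le> infdist (x k) C"
    by (simp only: projection(2))
qed

text \<open>
  Unless \<open>x 0\<close> is already in \<open>C\<close>, linear regularity at \<open>x 0\<close> forces \<open>\<kappa> \<ge> 1\<close>, since the distance to
  each \<open>Fix (U i)\<close> is at most the distance to \<open>C\<close>. Hence the contraction factor is nonnegative, and
  positive if \<open>s > 1\<close>.
\<close>

lemma linear_rate:
  assumes "s \<ge> 1" and regular: "\<And>i. i \<in> I \<Longrightarrow> linearly_regular (\<delta> i) B (U i)"
    and d: "d > 0" "\<And>i. i \<in> I \<Longrightarrow> d \<le> \<delta> i"
    and family: "linearly_regular_family \<kappa> B I (\<lambda>i. Fix (U i))"
    and \<mu>: "0 \<le> \<mu>" "\<mu> \<le> \<rho>" "\<mu> \<le> \<theta> * d\<^sup>2" "\<mu> \<le> 1"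
    and l: "x \<longlonglongrightarrow> l"
  shows "dist (x k) l \<le> 2 * infdist (x 0) C *
    root (2 * s) (1 - \<mu> / (real s * \<kappa>\<^sup>2)) powi (int k - int s + 1)"
proof (cases "infdist (x 0) C = 0")
  case True
  have "dist (x k) l \<le> 2 * infdist (x k) C"
    by (rule dist_limit_le[OF l])
  also have "infdist (x k) C \<le> infdist (x 0) C"
    by (rule decseqD[OF infdist_decseq]) simp
  finally show ?thesis
    unfolding True by simp
next
  case False
  then have pos: "0 < infdist (x 0) C"
    using infdist_nonneg[of "x 0" C] by simp
  have "\<kappa> > 0"
    using family by (simp add: linearly_regular_family_def)
  have "infdist (x 0) (Fix (U i)) \<le> infdist (x 0) C" if "i \<in> I" for i
    using that C_nonempty by (intro infdist_mono) auto
  then have max_le: "(MAX i\<in>I. infdist (x 0) (Fix (U i))) \<le> infdist (x 0) C"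
    using finite_I I_nonempty by (subst Max_le_iff) auto
  have "infdist (x 0) C \<le> \<kappa> * (MAX i\<in>I. infdist (x 0) (Fix (U i)))"
    using family iterates_in_B[of 0] unfolding linearly_regular_family_def by blast
  also have "\<dots> \<le> \<kappa> * infdist (x 0) C"
    using max_le less_imp_le[OF \<open>\<kappa> > 0\<close>] by (rule mult_left_mono)
  finally have "1 * infdist (x 0) C \<le> \<kappa> * infdist (x 0) C"
    by simp
  then have "1 \<le> \<kappa>"
    using pos by (rule mult_right_le_imp_le)
  define q where "q = 1 - \<mu> / (real s * \<kappa>\<^sup>2)"
  have "\<mu> / (real s * \<kappa>\<^sup>2) \<le> 1 / (real s * 1)"
    using \<mu> \<open>1 \<le> \<kappa>\<close> \<open>s \<ge> 1\<close> by (intro frac_le mult_left_mono one_le_power) auto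
  then have q_ge: "q \<ge> 1 - 1 / real s"
    by (simp add: q_def)
  have "q \<ge> 0"
    using \<open>s \<ge> 1\<close> by (intro order_trans[OF _ q_ge]) simp
  have "q > 0" if "s \<noteq> 1"
    using \<open>s \<ge> 1\<close> that by (intro less_le_trans[OF _ q_ge]) simp
  have "q \<le> 1"
    using \<mu>(1) by (simp add: q_def)
  have "infdist (x k) C \<le> infdist (x 0) C * root (2 * s) q powi (int k - int s + 1)"
  proof (rule block_contraction_imp_geometric_decay[OF _ infdist_decseq \<open>s \<ge> 1\<close> \<open>q \<ge> 0\<close> \<open>q \<le> 1\<close>])
    show "0 \<le> infdist (x k) C" for k
      by (rule infdist_nonneg)
    show "q > 0 \<or> s = 1"
      using \<open>s \<noteq> 1 \<Longrightarrow> q > 0\<close> by blast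
    show "(infdist (x (k + s)) C)\<^sup>2 \<le> q * (infdist (x k) C)\<^sup>2" for k
      unfolding q_def by (rule block_contraction[OF \<open>s \<ge> 1\<close> regular d family \<mu>(1-3)])
  qed
  then show ?thesis
    using dist_limit_le[OF l, of k] unfolding q_def by linarith
qed

lemma max_residual_le_dist:
  assumes "l \<in> C"
  shows "(MAX i\<in>I. norm (U i y - y)) \<le> dist y l"
  using finite_I I_nonempty cutter_residual_le_dist[OF cutters] assms by (subst Max_le_iff) auto

text \<open>
  The chain is: twice the distance to \<open>C\<close>, then the farthest \<open>Fix (U i)\<close> at the cost of \<open>\<kappa>\<close>, then its
  residual at the cost of \<open>1 / d\<close>.
\<close>

lemma dist_limit_le_max_residual:
  assumes regular: "\<And>i. i \<in> I \<Longrightarrow> linearly_regular (\<delta> i) B (U i)"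
    and d: "d > 0" "\<And>i. i \<in> I \<Longrightarrow> d \<le> \<delta> i"
    and family: "linearly_regular_family \<kappa> B I (\<lambda>i. Fix (U i))"
    and l: "x \<longlonglongrightarrow> l"
  shows "d / (2 * \<kappa>) * dist (x k) l \<le> (MAX i\<in>I. norm (U i (x k) - x k))"
proof -
  let ?R = "MAX i\<in>I. norm (U i (x k) - x k)"
  have "\<kappa> > 0"
    using family by (simp add: linearly_regular_family_def)
  have "infdist (x k) (Fix (U i)) \<le> ?R / d" if "i \<in> I" for i
  proof -
    have "d * infdist (x k) (Fix (U i)) \<le> \<delta> i * infdist (x k) (Fix (U i))"
      using d(2)[OF that] infdist_nonneg by (rule mult_right_mono)
    also have "\<dots> \<le> norm (U i (x k) - x k)"
      using regular[OF that] iterates_in_B[of k] unfolding linearly_regular_def by blast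
    also have "\<dots> \<le> ?R"
      using finite_I that by (intro Max_ge) auto
    finally show ?thesis
      using d(1) by (simp add: pos_le_divide_eq mult.commute)
  qed
  then have "(MAX i\<in>I. infdist (x k) (Fix (U i))) \<le> ?R / d"
    using finite_I I_nonempty by (subst Max_le_iff) auto
  then have "\<kappa> * (MAX i\<in>I. infdist (x k) (Fix (U i))) \<le> \<kappa> * (?R / d)"
    using \<open>\<kappa> > 0\<close> by (intro mult_left_mono) auto
  moreover have "infdist (x k) C \<le> \<kappa> * (MAX i\<in>I. infdist (x k) (Fix (U i)))"
    using family iterates_in_B[of k] unfolding linearly_regular_family_def by blast
  ultimately have "dist (x k) l \<le> 2 * (\<kappa> * (?R / d))"
    using dist_limit_le[OF l, of k] by linarith
  then have "d / (2 * \<kappa>) * dist (x k) l \<le> d / (2 * \<kappa>) * (2 * (\<kappa> * (?R / d)))"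
    using d(1) \<open>\<kappa> > 0\<close> by (intro mult_left_mono) auto
  then show ?thesis
    using d(1) \<open>\<kappa> > 0\<close> by simp
qed

lemma linear_regularity_imp_strong_convergence:
  assumes regular: "\<And>i. i \<in> I \<Longrightarrow> linearly_regular (\<delta> i) B (U i)"
    and family: "linearly_regular_family \<kappa> B I (\<lambda>i. Fix (U i))"
  obtains l where "l \<in> C \<inter> B" "x \<longlonglongrightarrow> l"
proof (rule strong_convergence)
  show "regular B (U i)" if "i \<in> I" for i
    using linearly_regular_imp_regular[OF regular[OF that]] .
  show "regular_family B I (\<lambda>i. Fix (U i))"
    using linearly_regular_family_imp_regular_family[OF family] .
qed

end

section \<open>Convergence of extrapolated simultaneous cutter methods\<close>

theorem corollary4p2:
  fixes U :: "nat \<Rightarrow> 'a \<Rightarrow> 'a::{real_inner, complete_space}"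
    and M s :: nat
    and x :: "nat \<Rightarrow> 'a"
    and J :: "nat \<Rightarrow> nat set"
    and w :: "nat \<Rightarrow> nat \<Rightarrow> real"
    and lam :: "nat \<Rightarrow> real"
    and \<sigma> :: "nat \<Rightarrow> 'a \<Rightarrow> real"
    and \<omega> lam_lo lam_hi :: real
  defines "I \<equiv> {1..M}"
  defines "C \<equiv> \<Inter>i\<in>I. Fix (U i)"
  defines "r \<equiv> infdist (x 0) C"
  defines "B \<equiv> cball (metric_projection C (x 0)) r"
  assumes cutters: "\<And>i. i \<in> I \<Longrightarrow> cutter (U i)"
    and C_nonempty: "C \<noteq> {}"
    and iteration: "\<And>k. x (Suc k) =
      x k + (lam k * \<sigma> k (x k)) *\<^sub>R ((\<Sum>i\<in>J k. w k i *\<^sub>R U i (x k)) - x k)"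
    and control: "\<And>k. J k \<subseteq> I" "\<And>k. J k \<noteq> {}"
    and weights_sum: "\<And>k. (\<Sum>i\<in>J k. w k i) = 1"
    and \<omega>: "\<omega> \<in> {0<..1}"
    and weights: "\<And>k i. i \<in> J k \<Longrightarrow> w k i \<in> {\<omega>..1}"
    and lam_lo: "lam_lo \<in> {0<..1}"
    and lam_hi: "lam_hi \<in> {1..<2}"
    and lam: "\<And>k. lam k \<in> {lam_lo..lam_hi}"
    and \<sigma>: "\<And>k y. \<sigma> k y \<in> {1..extrapolation_bound (J k) (w k) U y}"
    and s: "s \<ge> 1"
    and intermittent: "intermittent s I J"
  shows
    "((\<forall>i\<in>I. weakly_regular B (U i)) \<longrightarrow>
        (\<exists>l\<in>C \<inter> B. weakly_tendsto x l))
   \<and> ((\<forall>i\<in>I. regular B (U i)) \<and> regular_family B I (\<lambda>i. Fix (U i)) \<longrightarrow>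
        (\<exists>l\<in>C \<inter> B. x \<longlonglongrightarrow> l))
   \<and> (\<forall>\<delta> \<kappa>. (\<forall>i\<in>I. linearly_regular (\<delta> i) B (U i)) \<and>
            linearly_regular_family \<kappa> B I (\<lambda>i. Fix (U i)) \<longrightarrow>
        (\<exists>l\<in>C \<inter> B. x \<longlonglongrightarrow> l \<and>
          (let \<delta>min = (MIN i\<in>I. \<delta> i); \<rho> = (2 - lam_hi) / lam_hi in
            \<forall>k. \<delta>min / (2 * \<kappa>) * norm (x k - l) \<le> (MAX i\<in>I. norm (U i (x k) - x k))
              \<and> (MAX i\<in>I. norm (U i (x k) - x k)) \<le> norm (x k - l)
              \<and> norm (x k - l) \<le> 2 * infdist (x 0) C *
                  root (2 * s)
                    (1 - \<omega> * \<rho> * \<delta>min\<^sup>2 / (real s * \<kappa>\<^sup>2) *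
                      min (1 / (\<omega> * \<delta>min\<^sup>2))
                          (INF j. lam j * (2 - lam j) * \<sigma> j (x j)))
                  powi (int k - int s + 1))))"
proof -
  define \<rho> where "\<rho> = (2 - lam_hi) / lam_hi"
  define f where "f k = lam k * (2 - lam k) * \<sigma> k (x k)" for k
  define \<beta> where "\<beta> = (INF k. f k)"
  have \<rho>: "0 < \<rho>" "\<rho> \<le> 1"
    using lam_hi by (auto simp: \<rho>_def)
  have lam_bounds: "0 < lam k" "lam_lo \<le> lam k" "lam k \<le> lam_hi" "lam k < 2" for k
    using lam[of k] lam_lo lam_hi by auto
  have \<sigma>_ge: "1 \<le> \<sigma> k y" for k y
    using \<sigma>[of k y] by simp
  have f_ge: "lam_lo * (2 - lam_hi) \<le> f k" for k
  proof -
    have "lam_lo * (2 - lam_hi) * 1 \<le> lam k * (2 - lam k) * \<sigma> k (x k)"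
      using lam_bounds[of k] lam_lo lam_hi \<sigma>_ge[of k "x k"] by (intro mult_mono) auto
    then show ?thesis
      by (simp add: f_def)
  qed
  then have \<beta>_le: "\<beta> \<le> f k" for k
    unfolding \<beta>_def by (intro cINF_lower bdd_belowI2) auto
  have "lam_lo * (2 - lam_hi) \<le> \<beta>"
    unfolding \<beta>_def using f_ge by (intro cINF_greatest) auto
  moreover have "0 < lam_lo * (2 - lam_hi)"
    using lam_lo lam_hi by (intro mult_pos_pos) auto
  ultimately have \<beta>_pos: "\<beta> > 0"
    by linarith
  have "\<omega> > 0"
    using \<omega> by simp
  have J_finite: "finite (J k)" for k
    using control(1)[of k] finite_subset by (auto simp: I_def)
  have w_ge: "\<omega> \<le> w k i" "0 \<le> w k i" if "i \<in> J k" for k i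
    using weights[OF that] \<open>\<omega> > 0\<close> by auto
  define S where "S k = (\<Sum>i\<in>J k. w k i * (norm (U i (x k) - x k))\<^sup>2)" for k
  have S_nonneg: "0 \<le> S k" for k
    unfolding S_def using w_ge(2) by (intro sum_nonneg) auto
  have step: "f k * S k \<le> (dist (x k) z)\<^sup>2 - (dist (x (Suc k)) z)\<^sup>2"
      "(dist (x (Suc k)) (x k))\<^sup>2 \<le> (lam k)\<^sup>2 * \<sigma> k (x k) * S k" if "z \<in> C" for k z
  proof -
    have "cutter (U i)" "z \<in> Fix (U i)" if "i \<in> J k" for i
      using cutters control(1)[of k] that \<open>z \<in> C\<close> by (auto simp: C_def)
    from extrapolated_step_descent[OF this w_ge(2) weights_sum lam_bounds(1) \<sigma> iteration]
    show "f k * S k \<le> (dist (x k) z)\<^sup>2 - (dist (x (Suc k)) z)\<^sup>2"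
      "(dist (x (Suc k)) (x k))\<^sup>2 \<le> (lam k)\<^sup>2 * \<sigma> k (x k) * S k"
      unfolding f_def S_def by blast+
  qed
  interpret D: intermittent_descent U I J x s \<rho> "\<omega> * \<beta>"
  proof
    show "finite I"
      by (simp add: I_def)
    show "I \<noteq> {}"
      using control[of 0] by blast
    show "cutter (U i)" if "i \<in> I" for i
      using that by (rule cutters)
    show "(\<Inter>i\<in>I. Fix (U i)) \<noteq> {}"
      using C_nonempty unfolding C_def .
    show "intermittent s I J"
      by (rule intermittent)
    show "\<rho> > 0" "\<omega> * \<beta> > 0"
      using \<rho> \<beta>_pos \<open>\<omega> > 0\<close> by auto
    fix k z assume "z \<in> (\<Inter>i\<in>I. Fix (U i))"
    then have "z \<in> C"
      by (simp only: C_def)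
    \<comment> \<open>\<open>(2 - t) / t\<close> decreases in \<open>t\<close>, so its value \<open>\<rho>\<close> at \<open>lam_hi\<close> is a lower bound.\<close>
    have "\<rho> * lam k \<le> 2 - lam k"
      using lam_bounds[of k] lam_hi by (simp add: \<rho>_def field_simps)
    then have "\<rho> * lam k * (lam k * \<sigma> k (x k) * S k) \<le> (2 - lam k) * (lam k * \<sigma> k (x k) * S k)"
      using lam_bounds(1)[of k] \<sigma>_ge[of k "x k"] S_nonneg[of k] by (intro mult_right_mono) auto
    then have "\<rho> * ((lam k)\<^sup>2 * \<sigma> k (x k) * S k) \<le> f k * S k"
      by (simp add: f_def power2_eq_square algebra_simps)
    then show "\<rho> * (dist (x (Suc k)) (x k))\<^sup>2 \<le> (dist (x k) z)\<^sup>2 - (dist (x (Suc k)) z)\<^sup>2"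
      using mult_left_mono[OF step(2)[OF \<open>z \<in> C\<close>, of k], of \<rho>] step(1)[OF \<open>z \<in> C\<close>, of k] \<rho>(1)
      by linarith
    fix i assume "i \<in> J k"
    have "\<omega> * (norm (U i (x k) - x k))\<^sup>2 \<le> w k i * (norm (U i (x k) - x k))\<^sup>2"
      using w_ge(1)[OF \<open>i \<in> J k\<close>] by (intro mult_right_mono) auto
    also have "\<dots> \<le> S k"
      unfolding S_def using \<open>i \<in> J k\<close> J_finite w_ge(2)
      by (intro member_le_sum[of i "J k" "\<lambda>i. w k i * (norm (U i (x k) - x k))\<^sup>2"]) auto
    finally have "\<beta> * (\<omega> * (norm (U i (x k) - x k))\<^sup>2) \<le> f k * S k"
      using \<beta>_le[of k] \<beta>_pos \<open>\<omega> > 0\<close> by (intro mult_mono) auto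
    then show "\<omega> * \<beta> * (norm (U i (x k) - x k))\<^sup>2 \<le> (dist (x k) z)\<^sup>2 - (dist (x (Suc k)) z)\<^sup>2"
      using step(1)[OF \<open>z \<in> C\<close>, of k] by (simp add: mult.assoc mult.left_commute)
  qed
  have B: "D.B = B"
    by (simp only: B_def r_def C_def)
  have weak: "\<exists>l\<in>C \<inter> B. weakly_tendsto x l" if "\<forall>i\<in>I. weakly_regular B (U i)"
    using D.weak_convergence[unfolded B] that unfolding C_def by metis
  have strong: "\<exists>l\<in>C \<inter> B. x \<longlonglongrightarrow> l"
    if "(\<forall>i\<in>I. regular B (U i)) \<and> regular_family B I (\<lambda>i. Fix (U i))"
    using D.strong_convergence[unfolded B] that unfolding C_def by metis
  have linear: "\<exists>l\<in>C \<inter> B. x \<longlonglongrightarrow> l \<and>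
      (\<forall>k. dmin / (2 * \<kappa>) * norm (x k - l) \<le> (MAX i\<in>I. norm (U i (x k) - x k))
        \<and> (MAX i\<in>I. norm (U i (x k) - x k)) \<le> norm (x k - l)
        \<and> norm (x k - l) \<le> 2 * infdist (x 0) C *
            root (2 * s) (1 - \<omega> * \<rho> * dmin\<^sup>2 / (real s * \<kappa>\<^sup>2) * min (1 / (\<omega> * dmin\<^sup>2)) \<beta>)
              powi (int k - int s + 1))"
    if regular: "\<forall>i\<in>I. linearly_regular (\<delta> i) B (U i)"
      and family: "linearly_regular_family \<kappa> B I (\<lambda>i. Fix (U i))"
      and dmin: "dmin = (MIN i\<in>I. \<delta> i)" for \<delta> \<kappa> dmin
  proof -
    have regular': "linearly_regular (\<delta> i) D.B (U i)" if "i \<in> I" for i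
      using regular that unfolding B by blast
    have family': "linearly_regular_family \<kappa> D.B I (\<lambda>i. Fix (U i))"
      using family unfolding B .
    obtain l where l: "l \<in> D.C \<inter> D.B" "x \<longlonglongrightarrow> l"
      using D.linear_regularity_imp_strong_convergence[OF regular' family'] by blast
    have dmin_le: "dmin \<le> \<delta> i" if "i \<in> I" for i
      unfolding dmin using D.finite_I that by (intro Min_le) auto
    have "\<forall>i\<in>I. \<delta> i > 0"
      using regular by (simp add: linearly_regular_def)
    then have dmin_pos: "dmin > 0"
      unfolding dmin using D.finite_I D.I_nonempty by (subst Min_gr_iff) auto
    \<comment> \<open>The two terms of the minimum give \<open>\<mu> \<le> \<rho>\<close> and, since \<open>\<rho> \<le> 1\<close>, \<open>\<mu> \<le> \<omega> * \<beta> * dmin\<^sup>2\<close>.\<close>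
    define \<mu> where "\<mu> = \<omega> * \<rho> * dmin\<^sup>2 * min (1 / (\<omega> * dmin\<^sup>2)) \<beta>"
    have "0 \<le> \<mu>"
      using \<open>\<omega> > 0\<close> \<rho> \<beta>_pos by (simp add: \<mu>_def)
    have "\<mu> \<le> \<omega> * \<rho> * dmin\<^sup>2 * (1 / (\<omega> * dmin\<^sup>2))"
      unfolding \<mu>_def using \<open>\<omega> > 0\<close> \<rho> by (intro mult_left_mono) auto
    then have "\<mu> \<le> \<rho>"
      using \<open>\<omega> > 0\<close> dmin_pos by simp
    have "\<mu> \<le> \<omega> * \<rho> * dmin\<^sup>2 * \<beta>"
      unfolding \<mu>_def using \<open>\<omega> > 0\<close> \<rho> by (intro mult_left_mono) auto
    also have "\<dots> = \<rho> * (\<omega> * \<beta> * dmin\<^sup>2)"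
      by simp
    also have "\<dots> \<le> 1 * (\<omega> * \<beta> * dmin\<^sup>2)"
      using \<rho>(2) \<open>\<omega> > 0\<close> \<beta>_pos by (intro mult_right_mono) auto
    finally have "\<mu> \<le> \<omega> * \<beta> * dmin\<^sup>2"
      by simp
    note rate = D.linear_rate[OF s regular' dmin_pos dmin_le family' \<open>0 \<le> \<mu>\<close> \<open>\<mu> \<le> \<rho>\<close> this
        order_trans[OF \<open>\<mu> \<le> \<rho>\<close> \<rho>(2)] l(2)]
    have "\<mu> / (real s * \<kappa>\<^sup>2) = \<omega> * \<rho> * dmin\<^sup>2 / (real s * \<kappa>\<^sup>2) * min (1 / (\<omega> * dmin\<^sup>2)) \<beta>"
      by (simp add: \<mu>_def)
    with rate D.dist_limit_le_max_residual[OF regular' dmin_pos dmin_le family' l(2)]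
      D.max_residual_le_dist[of l] l
    show ?thesis
      unfolding B C_def dist_norm by (intro bexI[of _ l]) auto
  qed
  show ?thesis
    using weak strong linear unfolding Let_def \<beta>_def f_def \<rho>_def by blast
qed

end
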